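(* Let $G=B(n_1,n_2,P_2,m_2P_{k_2},\dots,m_tP_{k_t})$ be a strong double broom (so the hub vertices are adjacent), where $2<k_2<\dots<k_t$ and $m_i\ge 0$. Then $dern(G)=2$ if $\sum_{i=2}^t m_i=1$, $k_j>3$ for $2\le j\le t$, $n_1=1$ and $n_2\le 4$; and $dern(G)=1$ otherwise.
   Context: All graphs are finite, simple and undirected. For an edge $e$ of a graph $G$, $d(e)$ is the number of edges of $G$ adjacent to $e$. A da-ecard of $G$ is the pair $(d(e),G-e)$ with $G-e$ unlabeled; the da-edeck is the multiset of all da-ecards. $dern(G)$ is the size of the smallest sub-multiset of the da-edeck of $G$ not contained in the da-edeck of any graph $H\not\cong G$. A strong double broom is a graph on at least 5 vertices obtained from a union of at least two internally vertex disjoint paths with common ends $u,v$ (hub vertices) by appending leaves at $u$ and $v$. $B(n_1,n_2,m_1P_{k_1},\dots,m_tP_{k_t})$ (with $k_1<\dots<k_t$, $m_i\ge0$) denotes the strong double broom with $n_1$ leaves at $u$, $n_2$ leaves at $v$, and for each $i$ exactly $m_i$ internally vertex disjoint $(u,v)$-paths on $k_i$ vertices; here $P_2$ with multiplicity 1 means $u$ and $v$ are joined by an edge.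
   Formalization: The condition "n_1=1 and n_2≤4" is taken up to swapping n_1 and n_2, and "k_j>3" is required only for j with m_j>0; read literally, the same graph (e.g. B(1,2,P_2,P_4)=B(2,1,P_2,P_4)) would get two values of dern. Both hubs carry at least one leaf. *)

theory Defs
  imports "HOL-Library.Multiset" "HOL-Library.Extended_Nat"
begin

record 'a ugraph =
  verts :: "'a set"
  edges :: "'a set set"

definition simple_graph :: "'a ugraph \<Rightarrow> bool" where
  "simple_graph G \<longleftrightarrow> finite (verts G) \<and> (\<forall>e\<in>edges G. e \<subseteq> verts G \<and> card e = 2)"

definition isomorphic :: "'a ugraph \<Rightarrow> 'b ugraph \<Rightarrow> bool" (infix "\<cong>\<^sub>g" 50) where
  "G \<cong>\<^sub>g H \<longleftrightarrow> (\<exists>f. bij_betw f (verts G) (verts H) \<and> (\<lambda>e. f ` e) ` edges G = edges H)"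

definition del_edge :: "'a ugraph \<Rightarrow> 'a set \<Rightarrow> 'a ugraph" where
  "del_edge G e = \<lparr>verts = verts G, edges = edges G - {e}\<rparr>"

definition edge_degree :: "'a ugraph \<Rightarrow> 'a set \<Rightarrow> nat" where
  "edge_degree G e = card {e' \<in> edges G. e' \<noteq> e \<and> e' \<inter> e \<noteq> {}}"

text \<open>
  An unlabeled graph is an isomorphism class. Every finite graph has an isomorphic copy with
  vertices in \<^typ>\<open>nat\<close>, so the class is represented by the set of all these copies; this makes
  unlabeled graphs comparable even when the vertex types differ.
\<close>

definition unlabeled :: "'a ugraph \<Rightarrow> nat ugraph set" where
  "unlabeled G = {H. simple_graph H \<and> G \<cong>\<^sub>g H}"

definition da_ecard :: "'a ugraph \<Rightarrow> 'a set \<Rightarrow> nat \<times> nat ugraph set" where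
  "da_ecard G e = (edge_degree G e, unlabeled (del_edge G e))"

definition da_edeck :: "'a ugraph \<Rightarrow> (nat \<times> nat ugraph set) multiset" where
  "da_edeck G = image_mset (da_ecard G) (mset_set (edges G))"

text \<open>
  The value is in \<^typ>\<open>enat\<close> so that it is \<open>\<infinity>\<close>, rather than an arbitrary number, for a graph that is
  not determined by its whole da-edeck. The competitor \<open>H\<close> ranges over graphs on \<^typ>\<open>nat\<close>, that is,
  over all finite graphs up to isomorphism.
\<close>

definition dern :: "'a ugraph \<Rightarrow> enat" where
  "dern G = Inf {enat (size S) | S. S \<subseteq># da_edeck G \<and>
     (\<forall>H :: nat ugraph. simple_graph H \<and> \<not> H \<cong>\<^sub>g G \<longrightarrow> \<not> S \<subseteq># da_edeck H)}"

text \<open>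
  \<open>Inner i j p\<close> is the \<open>p\<close>-th vertex after \<open>HubU\<close> on the \<open>j\<close>-th of the paths with \<open>k i\<close> vertices.
\<close>

datatype broom_vertex = HubU | HubV | LeafU nat | LeafV nat | Inner nat nat nat

definition path_vertex :: "(nat \<Rightarrow> nat) \<Rightarrow> nat \<Rightarrow> nat \<Rightarrow> nat \<Rightarrow> broom_vertex" where
  "path_vertex k i j p = (if p = 0 then HubU else if p + 1 = k i then HubV else Inner i j p)"

text \<open>\<open>broom n1 n2 t m k\<close> is \<open>B(n1, n2, m 1 P_(k 1), ..., m t P_(k t))\<close>.\<close>

definition broom ::
  "nat \<Rightarrow> nat \<Rightarrow> nat \<Rightarrow> (nat \<Rightarrow> nat) \<Rightarrow> (nat \<Rightarrow> nat) \<Rightarrow> broom_vertex ugraph" where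
  "broom n1 n2 t m k = \<lparr>
     verts = {path_vertex k i j p | i j p. i \<in> {1..t} \<and> j < m i \<and> p < k i}
             \<union> LeafU ` {..<n1} \<union> LeafV ` {..<n2},
     edges = {{path_vertex k i j p, path_vertex k i j (p + 1)} | i j p.
               i \<in> {1..t} \<and> j < m i \<and> p + 1 < k i}
             \<union> {{HubU, LeafU l} | l. l < n1} \<union> {{HubV, LeafV l} | l. l < n2}\<rparr>"

text \<open>
  Both hubs carry at least one leaf. A path on two vertices is the edge joining the hubs, which
  occurs at most once in a simple graph.
\<close>

definition is_strong_double_broom ::
  "nat \<Rightarrow> nat \<Rightarrow> nat \<Rightarrow> (nat \<Rightarrow> nat) \<Rightarrow> (nat \<Rightarrow> nat) \<Rightarrow> bool" where
  "is_strong_double_broom n1 n2 t m k \<longleftrightarrow>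
     1 \<le> n1 \<and> 1 \<le> n2 \<and>
     strict_mono_on {1..t} k \<and>
     (\<forall>i\<in>{1..t}. 2 \<le> k i \<and> (k i = 2 \<longrightarrow> m i \<le> 1)) \<and>
     2 \<le> (\<Sum>i=1..t. m i) \<and>
     5 \<le> card (verts (broom n1 n2 t m k))"

end

theory Submission
  imports Defs
begin

text \<open>
  A graph having the card of \<open>e\<close> in its deck is \<open>G - e\<close> plus an edge between two nonadjacent vertices
  whose degrees in \<open>G - e\<close> add up to \<open>d(e)\<close>. In a double broom only the hubs can have degree above 2,
  so if both hubs still have degree at least 3 after deleting \<open>uv\<close>, the card of \<open>uv\<close> alone forces \<open>G\<close>.
  Otherwise there is a single further path and a hub with one leaf: \<open>G\<close> is a cycle with leaves at two
  adjacent vertices. If the path has three vertices, the card of \<open>uv\<close> still works; if the other hub \<open>v\<close>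
  has at least five leaves, the card of a leaf edge at \<open>v\<close> does, since no two vertices avoiding \<open>v\<close> have
  degree sum \<open>n2 + 1 \<ge> 6\<close>. In the remaining cases every card admits a second completion, but the cards of
  \<open>uv\<close> and of the leaf edge at \<open>u\<close> together force \<open>G\<close>.
\<close>

section \<open>Graphs with a prescribed card\<close>

definition degree :: "'a ugraph \<Rightarrow> 'a \<Rightarrow> nat" where
  "degree G x = card {y. {x, y} \<in> edges G}"

definition add_edge :: "'a ugraph \<Rightarrow> 'a set \<Rightarrow> 'a ugraph" where
  "add_edge G e = \<lparr>verts = verts G, edges = insert e (edges G)\<rparr>"

lemma verts_del_edge [simp]: "verts (del_edge G e) = verts G"
  and edges_del_edge [simp]: "edges (del_edge G e) = edges G - {e}"
  by (simp_all add: del_edge_def)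

lemma verts_add_edge [simp]: "verts (add_edge G e) = verts G"
  and edges_add_edge [simp]: "edges (add_edge G e) = insert e (edges G)"
  by (simp_all add: add_edge_def)

lemma add_del_edge: "e \<in> edges G \<Longrightarrow> add_edge (del_edge G e) e = G"
  by (cases G) (auto simp: add_edge_def del_edge_def)

lemma del_add_edge: "e \<notin> edges G \<Longrightarrow> del_edge (add_edge G e) e = G"
  by (cases G) (auto simp: add_edge_def del_edge_def)

lemma simple_graph_edgeD:
  assumes "simple_graph G" "{x, y} \<in> edges G"
  shows "x \<in> verts G" "y \<in> verts G" "x \<noteq> y"
  using assms by (force simp: simple_graph_def)+

lemma simple_graph_edgeE:
  assumes "simple_graph G" "e \<in> edges G"
  obtains x y where "e = {x, y}" "x \<noteq> y" "x \<in> verts G" "y \<in> verts G"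
  using assms unfolding simple_graph_def by (metis card_2_iff insert_subset)

lemma simple_graph_finite_edges: "simple_graph G \<Longrightarrow> finite (edges G)"
  unfolding simple_graph_def by (meson PowI finite_Pow_iff finite_subset subsetI)

lemma simple_graph_finite_nbrs: "simple_graph G \<Longrightarrow> finite {y. {x, y} \<in> edges G}"
  by (rule finite_subset[of _ "verts G"]) (auto simp: simple_graph_def)

lemma simple_graph_del_edge: "simple_graph G \<Longrightarrow> simple_graph (del_edge G e)"
  by (auto simp: simple_graph_def)

lemma simple_graph_add_edge:
  "simple_graph G \<Longrightarrow> x \<in> verts G \<Longrightarrow> y \<in> verts G \<Longrightarrow> x \<noteq> y \<Longrightarrow> simple_graph (add_edge G {x, y})"
  by (auto simp: simple_graph_def)

lemma degree_add_edge:
  assumes "simple_graph G" "{x, y} \<notin> edges G" "x \<noteq> y"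
  shows "degree (add_edge G {x, y}) z = degree G z + (if z = x \<or> z = y then 1 else 0)"
proof -
  have "{w. {z, w} \<in> edges (add_edge G {x, y})} =
    (if z = x then insert y {w. {z, w} \<in> edges G}
     else if z = y then insert x {w. {z, w} \<in> edges G} else {w. {z, w} \<in> edges G})"
    using assms(3) by (auto simp: doubleton_eq_iff)
  then show ?thesis
    using assms simple_graph_finite_nbrs[OF assms(1), of z]
    by (auto simp: degree_def insert_commute)
qed

lemma degree_del_edge:
  assumes "simple_graph G" "{x, y} \<in> edges G"
  shows "degree G z = degree (del_edge G {x, y}) z + (if z = x \<or> z = y then 1 else 0)"
  using degree_add_edge[OF simple_graph_del_edge[OF assms(1), of "{x, y}"], of x y z]
    simple_graph_edgeD(3)[OF assms] add_del_edge[OF assms(2)] by simp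

text \<open>An edge adjacent to \<open>{x, y}\<close> meets exactly one of its ends, as
  \<open>x \<noteq> y\<close> and \<open>{x, y}\<close> itself is excluded. Thus the edge degree
  becomes a degree sum in the edge-deleted graph, that is, a condition on where the missing edge can
  go.\<close>

lemma edge_degree_del_edge:
  assumes "simple_graph G" "{x, y} \<in> edges G"
  shows "edge_degree G {x, y} = degree (del_edge G {x, y}) x + degree (del_edge G {x, y}) y"
proof -
  let ?D = "del_edge G {x, y}"
  let ?X = "(\<lambda>w. {x, w}) ` {w. {x, w} \<in> edges ?D}"
  let ?Y = "(\<lambda>w. {y, w}) ` {w. {y, w} \<in> edges ?D}"
  have fin: "finite {w. {z, w} \<in> edges ?D}" for z
    by (rule simple_graph_finite_nbrs[OF simple_graph_del_edge[OF assms(1)]])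
  have "{e' \<in> edges G. e' \<noteq> {x, y} \<and> e' \<inter> {x, y} \<noteq> {}} = ?X \<union> ?Y" (is "?L = _")
  proof
    show "?L \<subseteq> ?X \<union> ?Y"
    proof
      fix e assume e: "e \<in> ?L"
      then obtain p q where pq: "e = {p, q}" using simple_graph_edgeE[OF assms(1)] by blast
      then have "p = x \<or> p = y \<or> q = x \<or> q = y" using e by auto
      then show "e \<in> ?X \<union> ?Y" using e pq by (auto simp: insert_commute)
    qed
  qed auto
  moreover have "?X \<inter> ?Y = {}"
    using simple_graph_edgeD(3)[OF assms] by (auto simp: doubleton_eq_iff)
  moreover have "card ?X = degree ?D x" "card ?Y = degree ?D y"
    unfolding degree_def by (rule card_image, auto simp: inj_on_def doubleton_eq_iff)+
  ultimately show ?thesis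
    unfolding edge_degree_def using fin by (simp add: card_Un_disjoint)
qed

lemma edge_degree_eq:
  assumes "simple_graph G" "{x, y} \<in> edges G"
  shows "edge_degree G {x, y} + 2 = degree G x + degree G y"
  using edge_degree_del_edge[OF assms] degree_del_edge[OF assms, of x] degree_del_edge[OF assms, of y]
  by simp

text \<open>The truncated subtraction is harmless: \<open>p\<close> and \<open>q\<close> lie on an
  edge of \<open>G\<close>, so their degrees are positive.\<close>

lemma degree_replace_edge:
  assumes "simple_graph G" "{p, q} \<in> edges G" "{x, y} \<notin> edges G" "x \<noteq> y"
  shows "degree (add_edge (del_edge G {p, q}) {x, y}) z =
     degree G z - (if z = p \<or> z = q then 1 else 0) + (if z = x \<or> z = y then 1 else 0)"
  using degree_del_edge[OF assms(1,2), of z] assms(3,4)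
    degree_add_edge[OF simple_graph_del_edge[OF assms(1)], of x y "{p, q}" z] by auto

section \<open>Isomorphism invariance of cards and decks\<close>

text \<open>Simplicity puts every edge inside the vertex set, which is where the inverse of
  \<open>f\<close> is known to cancel \<open>f\<close>.\<close>

lemma isomorphic_sym:
  assumes "simple_graph G" "G \<cong>\<^sub>g H"
  shows "H \<cong>\<^sub>g G"
proof -
  obtain f where f: "bij_betw f (verts G) (verts H)" "(`) f ` edges G = edges H"
    using assms(2) by (auto simp: isomorphic_def)
  have "inv_into (verts G) f ` (f ` e) = e" if "e \<in> edges G" for e
    using assms(1) f(1) that by (metis bij_betw_imp_inj_on inv_into_image_cancel simple_graph_def)
  then have "(`) (inv_into (verts G) f) ` edges H = edges G"
    unfolding f(2)[symmetric] by (auto simp: image_image)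
  then show ?thesis
    unfolding isomorphic_def using bij_betw_inv_into[OF f(1)] by blast
qed

lemma isomorphic_trans:
  assumes "G \<cong>\<^sub>g H" "H \<cong>\<^sub>g K"
  shows "G \<cong>\<^sub>g K"
proof -
  obtain f g where f: "bij_betw f (verts G) (verts H)" "(`) f ` edges G = edges H"
    and g: "bij_betw g (verts H) (verts K)" "(`) g ` edges H = edges K"
    using assms by (auto simp: isomorphic_def)
  have "(`) (g \<circ> f) ` edges G = edges K"
    unfolding g(2)[symmetric] f(2)[symmetric] by (auto simp: image_comp)
  then show ?thesis
    unfolding isomorphic_def using bij_betw_trans[OF f(1) g(1)] by blast
qed

lemma isomorphic_simple_graph:
  assumes "simple_graph G" "G \<cong>\<^sub>g H"
  shows "simple_graph H"
proof -
  obtain f where f: "bij_betw f (verts G) (verts H)" "(`) f ` edges G = edges H"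
    using assms(2) by (auto simp: isomorphic_def)
  have "card (f ` e) = 2 \<and> f ` e \<subseteq> verts H" if "e \<in> edges G" for e
    using assms(1) f(1) that unfolding simple_graph_def bij_betw_def
    by (metis card_image image_mono inj_on_subset)
  then show ?thesis
    using assms(1) bij_betw_finite[OF f(1)] unfolding simple_graph_def f(2)[symmetric] by auto
qed

lemma isomorphic_edge_iff:
  assumes "simple_graph G" "bij_betw f (verts G) (verts H)" "(`) f ` edges G = edges H"
    and "x \<in> verts G" "y \<in> verts G"
  shows "{f x, f y} \<in> edges H \<longleftrightarrow> {x, y} \<in> edges G"
proof
  assume "{f x, f y} \<in> edges H"
  then have "f ` {x, y} \<in> (`) f ` edges G" using assms(3) by simp
  then obtain e where e: "f ` {x, y} = f ` e" "e \<in> edges G" by (rule imageE)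
  moreover have "e \<subseteq> verts G" using assms(1) e(2) by (simp add: simple_graph_def)
  ultimately have "{x, y} = e"
    using inj_on_image_eq_iff[of f "verts G" "{x, y}" e] assms(2,4,5) by (auto simp: bij_betw_def)
  then show "{x, y} \<in> edges G" using e by simp
next
  assume "{x, y} \<in> edges G"
  then have "f ` {x, y} \<in> (`) f ` edges G" by (rule imageI)
  then show "{f x, f y} \<in> edges H" using assms(3) by simp
qed

lemma isomorphic_degree:
  assumes "simple_graph G" "bij_betw f (verts G) (verts H)" "(`) f ` edges G = edges H"
    and "x \<in> verts G"
  shows "degree H (f x) = degree G x"
proof -
  have H: "simple_graph H" using assms isomorphic_simple_graph unfolding isomorphic_def by blast
  have "{y. {f x, y} \<in> edges H} = f ` {y. {x, y} \<in> edges G}"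
  proof (intro equalityI subsetI)
    fix z assume z: "z \<in> {y. {f x, y} \<in> edges H}"
    then obtain y where "z = f y" "y \<in> verts G"
      using simple_graph_edgeD(2)[OF H] assms(2) unfolding bij_betw_def
      by (metis imageE mem_Collect_eq)
    then show "z \<in> f ` {y. {x, y} \<in> edges G}" using z isomorphic_edge_iff[OF assms] by auto
  qed (use isomorphic_edge_iff[OF assms] simple_graph_edgeD[OF assms(1)] in auto)
  moreover have "inj_on f {y. {x, y} \<in> edges G}"
    using assms(2) simple_graph_edgeD[OF assms(1)]
    by (metis (no_types, lifting) bij_betw_imp_inj_on inj_on_subset mem_Collect_eq subsetI)
  ultimately show ?thesis by (simp add: degree_def card_image)
qed

lemma ex_nat_isomorphic:
  assumes "simple_graph G"
  obtains H :: "nat ugraph" where "simple_graph H" "G \<cong>\<^sub>g H"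
proof -
  obtain f where f: "bij_betw f (verts G) {0..<card (verts G)}"
    using assms ex_bij_betw_finite_nat[of "verts G"] by (auto simp: simple_graph_def)
  define H where "H = \<lparr>verts = {0..<card (verts G)}, edges = (`) f ` edges G\<rparr>"
  have "G \<cong>\<^sub>g H" unfolding isomorphic_def H_def using f by auto
  then show ?thesis by (intro that isomorphic_simple_graph[OF assms])
qed

text \<open>The classes are nonempty, so equal classes share a copy \<open>K\<close>, through which
  \<open>G\<close> and \<open>H\<close> are linked.\<close>

lemma unlabeled_eqD:
  assumes "simple_graph G" "simple_graph H" "unlabeled G = unlabeled H"
  shows "G \<cong>\<^sub>g H"
proof -
  obtain K :: "nat ugraph" where K: "simple_graph K" "G \<cong>\<^sub>g K"
    using ex_nat_isomorphic[OF assms(1)] by blast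
  then have "H \<cong>\<^sub>g K" using assms(3) by (auto simp: unlabeled_def)
  then show ?thesis
    by (rule isomorphic_trans[OF K(2) isomorphic_sym[OF assms(2)]])
qed

lemma unlabeled_cong:
  assumes "simple_graph G" "G \<cong>\<^sub>g H"
  shows "unlabeled G = unlabeled H"
proof -
  have "G \<cong>\<^sub>g K \<longleftrightarrow> H \<cong>\<^sub>g K" for K :: "nat ugraph"
    by (rule iffI; rule isomorphic_trans[OF isomorphic_sym[OF assms]] isomorphic_trans[OF assms(2)])
  then show ?thesis by (simp add: unlabeled_def)
qed

text \<open>One map serves both components of the card: \<open>f\<close> is also an isomorphism of
  the edge-deleted graphs, and the edge degree is a degree sum there.\<close>

lemma da_ecard_isomorphic:
  assumes "simple_graph G" "bij_betw f (verts G) (verts H)" "(`) f ` edges G = edges H"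
    and "e \<in> edges G"
  shows "da_ecard H (f ` e) = da_ecard G e"
proof -
  obtain x y where e: "e = {x, y}" "x \<noteq> y" "x \<in> verts G" "y \<in> verts G"
    using assms simple_graph_edgeE by metis
  have H: "simple_graph H" using assms isomorphic_simple_graph unfolding isomorphic_def by blast
  have fe: "{f x, f y} \<in> edges H" using isomorphic_edge_iff[OF assms(1-3)] e assms(4) by blast
  \<comment> \<open>Injectivity on edges lets deletion of \<open>e\<close> commute with taking
    images.\<close>
  have "inj_on ((`) f) (edges G)"
    using bij_betw_imp_inj_on[OF assms(2)] assms(1)
    by (auto simp: simple_graph_def inj_on_def[of "(`) f"] inj_on_image_eq_iff)
  then have "(`) f ` (edges G - {e}) = (`) f ` edges G - (`) f ` {e}"
    using assms(4) by (intro inj_on_image_set_diff) auto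
  then have im: "(`) f ` edges (del_edge G e) = edges (del_edge H (f ` e))"
    using assms(3) by simp
  have bij: "bij_betw f (verts (del_edge G e)) (verts (del_edge H (f ` e)))"
    using assms(2) by simp
  note deg = isomorphic_degree[OF simple_graph_del_edge[OF assms(1)] bij im]
  have "edge_degree H (f ` e) = edge_degree G e"
    using edge_degree_del_edge[OF assms(1), of x y] edge_degree_del_edge[OF H fe]
      deg[of x] deg[of y] e assms(4) by simp
  moreover have "del_edge G e \<cong>\<^sub>g del_edge H (f ` e)"
    using bij im unfolding isomorphic_def by blast
  ultimately show ?thesis
    unfolding da_ecard_def using unlabeled_cong simple_graph_del_edge[OF assms(1)] by blast
qed

lemma da_edeck_isomorphic:
  assumes "simple_graph G" "G \<cong>\<^sub>g H"
  shows "da_edeck G = da_edeck H"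
proof -
  obtain f where f: "bij_betw f (verts G) (verts H)" "(`) f ` edges G = edges H"
    using assms(2) by (auto simp: isomorphic_def)
  have "inj_on ((`) f) (edges G)"
    using bij_betw_imp_inj_on[OF f(1)] assms(1)
    by (auto simp: simple_graph_def inj_on_def[of "(`) f"] inj_on_image_eq_iff)
  then have "mset_set (edges H) = image_mset ((`) f) (mset_set (edges G))"
    using f(2) by (simp add: image_mset_mset_set)
  then have "da_edeck H = image_mset (\<lambda>e. da_ecard H (f ` e)) (mset_set (edges G))"
    by (simp add: da_edeck_def image_mset.compositionality comp_def)
  also have "\<dots> = da_edeck G"
    unfolding da_edeck_def
    using da_ecard_isomorphic[OF assms(1) f] simple_graph_finite_edges[OF assms(1)]
    by (intro image_mset_cong) auto
  finally show ?thesis by simp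
qed

lemma in_da_edeck_iff: "simple_graph G \<Longrightarrow> c \<in># da_edeck G \<longleftrightarrow> c \<in> da_ecard G ` edges G"
  by (simp add: da_edeck_def simple_graph_finite_edges)

text \<open>Some edge of \<open>H\<close> owns the card; its ends are pulled back to
  \<open>x\<close>, \<open>y\<close> along the isomorphism between the two edge-deleted graphs.
  Hence every competitor is, up to isomorphism, a completion of \<open>G - e\<close> by a
  nonadjacent pair of prescribed degree sum.\<close>

lemma graph_with_card:
  assumes "simple_graph G" "simple_graph H" "da_ecard G e \<in># da_edeck H"
  obtains x y where "x \<in> verts G" "y \<in> verts G" "x \<noteq> y" "{x, y} \<notin> edges (del_edge G e)"
    "degree (del_edge G e) x + degree (del_edge G e) y = edge_degree G e"
    "add_edge (del_edge G e) {x, y} \<cong>\<^sub>g H"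
proof -
  let ?D = "del_edge G e"
  obtain f where f: "f \<in> edges H" "da_ecard G e = da_ecard H f"
    using assms(2,3) in_da_edeck_iff by blast
  have D: "simple_graph ?D" "simple_graph (del_edge H f)"
    using assms simple_graph_del_edge by auto
  have "?D \<cong>\<^sub>g del_edge H f" using f(2) unlabeled_eqD[OF D] by (simp add: da_ecard_def)
  then obtain g where g: "bij_betw g (verts ?D) (verts (del_edge H f))"
    "(`) g ` edges ?D = edges (del_edge H f)"
    unfolding isomorphic_def by auto
  obtain p q where pq: "f = {p, q}" "p \<noteq> q" "p \<in> verts H" "q \<in> verts H"
    using simple_graph_edgeE[OF assms(2) f(1)] by metis
  obtain x y where xy: "x \<in> verts G" "y \<in> verts G" "p = g x" "q = g y"
    using g(1) pq unfolding bij_betw_def by (metis imageE verts_del_edge)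
  note deg = isomorphic_degree[OF D(1) g]
  have nonedge: "{x, y} \<notin> edges ?D"
    using isomorphic_edge_iff[OF D(1) g, of x y] xy pq(1) by simp
  have "degree ?D x + degree ?D y = edge_degree H f"
    using edge_degree_del_edge[OF assms(2), of p q] f pq deg[of x] deg[of y] xy by simp
  then have sum: "degree ?D x + degree ?D y = edge_degree G e"
    using f(2) by (simp add: da_ecard_def)
  have "(`) g ` edges (add_edge ?D {x, y}) = insert f (edges H - {f})"
    using g(2) pq xy by auto
  then have "add_edge ?D {x, y} \<cong>\<^sub>g H"
    unfolding isomorphic_def using g(1) f(1) by (intro exI[of _ g]) (auto simp: insert_absorb)
  then show ?thesis using that nonedge sum xy pq by blast
qed

section \<open>Bounds on \<open>dern\<close> from completions of cards\<close>

lemma dern_isomorphic: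
  assumes "simple_graph G" "G \<cong>\<^sub>g H"
  shows "dern G = dern H"
proof -
  have "K \<cong>\<^sub>g G \<longleftrightarrow> K \<cong>\<^sub>g H" for K :: "nat ugraph"
    by (rule iffI; rule isomorphic_trans[OF _ isomorphic_sym[OF assms]] isomorphic_trans[OF _ assms(2)])
  then show ?thesis unfolding dern_def da_edeck_isomorphic[OF assms] by simp
qed

lemma dern_le:
  assumes "S \<subseteq># da_edeck G"
    and "\<And>H :: nat ugraph. simple_graph H \<Longrightarrow> S \<subseteq># da_edeck H \<Longrightarrow> H \<cong>\<^sub>g G"
  shows "dern G \<le> enat (size S)"
  unfolding dern_def by (rule Inf_lower) (use assms in blast)

text \<open>Rules out the empty multiset of cards, which lies in every deck.\<close>

lemma ex_nonisomorphic:
  obtains H :: "nat ugraph" where "simple_graph H" "\<not> H \<cong>\<^sub>g G"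
proof
  \<comment> \<open>\<open>{..c}\<close> has \<open>c + 1\<close> elements, so the vertex counts
    differ.\<close>
  define H :: "nat ugraph" where "H = \<lparr>verts = {..card (verts G)}, edges = {}\<rparr>"
  show "simple_graph H" by (simp add: H_def simple_graph_def)
  show "\<not> H \<cong>\<^sub>g G"
    unfolding isomorphic_def H_def by (auto dest: bij_betw_same_card)
qed

lemma dern_ge_1: "1 \<le> dern G"
  unfolding dern_def
proof (rule Inf_greatest)
  fix n assume "n \<in> {enat (size S) | S. S \<subseteq># da_edeck G \<and>
     (\<forall>H :: nat ugraph. simple_graph H \<and> \<not> H \<cong>\<^sub>g G \<longrightarrow> \<not> S \<subseteq># da_edeck H)}"
  then obtain S where S: "n = enat (size S)"
    "\<And>H :: nat ugraph. simple_graph H \<Longrightarrow> \<not> H \<cong>\<^sub>g G \<Longrightarrow> \<not> S \<subseteq># da_edeck H" by auto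
  then have "S \<noteq> {#}" using ex_nonisomorphic[of G] by (metis empty_le)
  then show "1 \<le> n" using S(1) by (simp add: one_enat_def Suc_le_eq nonempty_has_size)
qed

text \<open>The second completion of the card of \<open>e\<close> has that card in its own deck, at
  the new edge \<open>{x, y}\<close>, so no single card singles out \<open>G\<close>.\<close>

lemma dern_ge_2:
  assumes "simple_graph G"
    and "\<And>e. e \<in> edges G \<Longrightarrow> \<exists>x\<in>verts G. \<exists>y\<in>verts G. x \<noteq> y \<and> {x, y} \<notin> edges G \<and>
      degree (del_edge G e) x + degree (del_edge G e) y = edge_degree G e \<and>
      \<not> add_edge (del_edge G e) {x, y} \<cong>\<^sub>g G"
  shows "2 \<le> dern G"
  unfolding dern_def
proof (rule Inf_greatest)
  fix n assume "n \<in> {enat (size S) | S. S \<subseteq># da_edeck G \<and>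
     (\<forall>H :: nat ugraph. simple_graph H \<and> \<not> H \<cong>\<^sub>g G \<longrightarrow> \<not> S \<subseteq># da_edeck H)}"
  then obtain S where S: "n = enat (size S)" "S \<subseteq># da_edeck G"
    "\<And>H :: nat ugraph. simple_graph H \<Longrightarrow> \<not> H \<cong>\<^sub>g G \<Longrightarrow> \<not> S \<subseteq># da_edeck H" by auto
  have False if single: "S = {#c#}" for c
  proof -
    obtain e where e: "e \<in> edges G" "c = da_ecard G e"
      using S(2) single in_da_edeck_iff[OF assms(1)] by auto
    obtain x y where xy: "x \<in> verts G" "y \<in> verts G" "x \<noteq> y" "{x, y} \<notin> edges G"
      "degree (del_edge G e) x + degree (del_edge G e) y = edge_degree G e"
      "\<not> add_edge (del_edge G e) {x, y} \<cong>\<^sub>g G"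
      using assms(2)[OF e(1)] by blast
    let ?K = "add_edge (del_edge G e) {x, y}"
    have K: "simple_graph ?K"
      using simple_graph_add_edge[OF simple_graph_del_edge[OF assms(1)]] xy by simp
    \<comment> \<open>As \<open>{x, y}\<close> is no edge of \<open>G\<close>, removing it returns
      \<open>G - e\<close>; the degree sum then makes the edge degrees agree as well.\<close>
    have "del_edge ?K {x, y} = del_edge G e" using xy(4) by (simp add: del_add_edge)
    then have "da_ecard ?K {x, y} = c"
      using edge_degree_del_edge[OF K, of x y] xy(5) e(2) by (simp add: da_ecard_def)
    then have c: "c \<in># da_edeck ?K" using in_da_edeck_iff[OF K] by auto
    obtain H :: "nat ugraph" where H: "simple_graph H" "?K \<cong>\<^sub>g H"
      using ex_nat_isomorphic[OF K] by blast
    then have "\<not> H \<cong>\<^sub>g G" using xy(6) isomorphic_trans by blast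
    then show False using S(3)[OF H(1)] c single da_edeck_isomorphic[OF K H(2)] by simp
  qed
  moreover have "S \<noteq> {#}" using S(3) ex_nonisomorphic[of G] by (metis empty_le)
  ultimately have "size S \<noteq> 0" "size S \<noteq> 1"
    using size_1_singleton_mset[of S] by (metis size_eq_0_iff_empty, metis)
  then have "2 \<le> size S" by linarith
  then show "2 \<le> n" using S(1) by (simp add: numeral_eq_enat)
qed

text \<open>If \<open>e\<close> is the only admissible place for the missing edge, every graph with
  the card of \<open>e\<close> is the one completion \<open>G\<close>.\<close>

lemma dern_eq_1:
  assumes "simple_graph G" "e \<in> edges G"
    and "\<And>x y. x \<in> verts G \<Longrightarrow> y \<in> verts G \<Longrightarrow> x \<noteq> y \<Longrightarrow> {x, y} \<notin> edges (del_edge G e) \<Longrightarrow>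
      degree (del_edge G e) x + degree (del_edge G e) y = edge_degree G e \<Longrightarrow> {x, y} = e"
  shows "dern G = 1"
proof -
  have "dern G \<le> enat (size {#da_ecard G e#})"
  proof (rule dern_le)
    show "{#da_ecard G e#} \<subseteq># da_edeck G"
      using assms(2) in_da_edeck_iff[OF assms(1)] by simp
    fix H :: "nat ugraph" assume H: "simple_graph H" "{#da_ecard G e#} \<subseteq># da_edeck H"
    then obtain x y where "x \<in> verts G" "y \<in> verts G" "x \<noteq> y" "{x, y} \<notin> edges (del_edge G e)"
      "degree (del_edge G e) x + degree (del_edge G e) y = edge_degree G e"
      and iso: "add_edge (del_edge G e) {x, y} \<cong>\<^sub>g H"
      using graph_with_card[OF assms(1) H(1)] by (metis single_subset_iff)
    then have "{x, y} = e" using assms(3) by blast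
    then have "G \<cong>\<^sub>g H" using iso add_del_edge[OF assms(2)] by simp
    then show "H \<cong>\<^sub>g G" using isomorphic_sym[OF assms(1)] by blast
  qed
  then show ?thesis using dern_ge_1[of G] by (simp add: one_enat_def)
qed

text \<open>The first card makes a competitor a completion of \<open>G - e\<close>; the second card
  must then occur in that completion, at some edge \<open>f\<close>. The last assumption says that
  this leaves only the original position of \<open>e\<close>.\<close>

lemma dern_le_2:
  assumes "simple_graph G" "e \<in> edges G" "e' \<in> edges G" "e \<noteq> e'"
    and "\<And>x y f. x \<in> verts G \<Longrightarrow> y \<in> verts G \<Longrightarrow> x \<noteq> y \<Longrightarrow> {x, y} \<notin> edges (del_edge G e) \<Longrightarrow>
      degree (del_edge G e) x + degree (del_edge G e) y = edge_degree G e \<Longrightarrow>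
      f \<in> edges (add_edge (del_edge G e) {x, y}) \<Longrightarrow>
      edge_degree (add_edge (del_edge G e) {x, y}) f = edge_degree G e' \<Longrightarrow>
      del_edge G e' \<cong>\<^sub>g del_edge (add_edge (del_edge G e) {x, y}) f \<Longrightarrow> {x, y} = e"
  shows "dern G \<le> 2"
proof -
  let ?S = "image_mset (da_ecard G) (mset_set {e, e'})"
  have "dern G \<le> enat (size ?S)"
  proof (rule dern_le)
    show "?S \<subseteq># da_edeck G"
      unfolding da_edeck_def
      using assms(2,3) simple_graph_finite_edges[OF assms(1)]
      by (intro image_mset_subseteq_mono subset_imp_msubset_mset_set) auto
    fix H :: "nat ugraph" assume H: "simple_graph H" "?S \<subseteq># da_edeck H"
    have cards: "da_ecard G e \<in># da_edeck H" "da_ecard G e' \<in># da_edeck H"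
      using mset_subset_eqD[OF H(2)] by simp_all
    obtain x y where xy: "x \<in> verts G" "y \<in> verts G" "x \<noteq> y" "{x, y} \<notin> edges (del_edge G e)"
      "degree (del_edge G e) x + degree (del_edge G e) y = edge_degree G e"
      and iso: "add_edge (del_edge G e) {x, y} \<cong>\<^sub>g H"
      using graph_with_card[OF assms(1) H(1) cards(1)] by metis
    let ?K = "add_edge (del_edge G e) {x, y}"
    have K: "simple_graph ?K"
      using simple_graph_add_edge[OF simple_graph_del_edge[OF assms(1)]] xy by simp
    have "da_ecard G e' \<in># da_edeck ?K" using cards(2) da_edeck_isomorphic[OF K iso] by simp
    then obtain f where f: "f \<in> edges ?K" "da_ecard G e' = da_ecard ?K f"
      using in_da_edeck_iff[OF K] by (metis imageE)
    then have "del_edge G e' \<cong>\<^sub>g del_edge ?K f"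
      using unlabeled_eqD[OF simple_graph_del_edge[OF assms(1)] simple_graph_del_edge[OF K]]
      by (simp add: da_ecard_def)
    then have "{x, y} = e" using assms(5)[OF xy f(1)] f(2) by (simp add: da_ecard_def)
    then have "G \<cong>\<^sub>g H" using iso add_del_edge[OF assms(2)] by simp
    then show "H \<cong>\<^sub>g G" by (rule isomorphic_sym[OF assms(1)])
  qed
  moreover have "size ?S = 2" using assms(4) by simp
  ultimately show ?thesis by (simp only: numeral_eq_enat)
qed

section \<open>Cycles with leaves at two adjacent vertices\<close>

text \<open>
  In \<open>lasso k n\<close> the hubs are 1 and \<open>k\<close>, with leaves 0 and \<open>k + 1, \<dots>, k + n\<close> respectively.
\<close>

definition lasso_adj :: "nat \<Rightarrow> nat \<Rightarrow> nat \<Rightarrow> nat \<Rightarrow> bool" where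
  "lasso_adj k n x y \<longleftrightarrow> x < k \<and> y = x + 1 \<or> x = k \<and> k < y \<and> y \<le> k + n \<or> x = 1 \<and> y = k"

definition lasso :: "nat \<Rightarrow> nat \<Rightarrow> nat ugraph" where
  "lasso k n = \<lparr>verts = {..k + n}, edges = {{x, y} | x y. lasso_adj k n x y}\<rparr>"

lemma verts_lasso [simp]: "verts (lasso k n) = {..k + n}"
  by (simp add: lasso_def)

lemma lasso_edge_iff: "{x, y} \<in> edges (lasso k n) \<longleftrightarrow> lasso_adj k n x y \<or> lasso_adj k n y x"
  by (auto simp: lasso_def doubleton_eq_iff)

lemma simple_graph_lasso:
  assumes "3 \<le> k"
  shows "simple_graph (lasso k n)"
  using assms by (auto simp: simple_graph_def lasso_def lasso_adj_def card_insert_if)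

lemma degree_lasso:
  assumes "3 \<le> k" "x \<le> k + n"
  shows "degree (lasso k n) x =
    (if x = 0 \<or> k < x then 1 else if x = 1 then 3 else if x = k then n + 2 else 2)"
proof -
  have "{y. {x, y} \<in> edges (lasso k n)} =
    (if x = 0 then {1} else if k < x then {k} else if x = 1 then {0, 2, k}
     else if x = k then {1, k - 1} \<union> {k<..k + n} else {x - 1, x + 1})"
    using assms by (auto simp: lasso_edge_iff lasso_adj_def)
  \<comment> \<open>\<open>3 \<le> k\<close> keeps the hub neighbour 1 of \<open>k\<close> apart
    from its path neighbour \<open>k - 1\<close>.\<close>
  moreover have "card ({1, k - 1} \<union> {k<..k + n}) = n + 2"
    using assms(1) by (subst card_Un_disjoint) auto
  ultimately show ?thesis using assms by (simp add: degree_def)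
qed

section \<open>Lassos determined by one card\<close>

text \<open>Without the edge \<open>{1, 3}\<close> the required degree sum is \<open>n + 3\<close>.
  A pair containing 3 needs a partner of degree 2, and of the candidates 1 and 2 only 1 is not
  adjacent to 3. A pair avoiding 3 has sum at most 4, attained only by the adjacent vertices 1 and
  2.\<close>

lemma dern_lasso_3:
  assumes "1 \<le> n"
  shows "dern (lasso 3 n) = 1"
proof -
  let ?L = "lasso 3 n"
  have L: "simple_graph ?L" by (simp add: simple_graph_lasso)
  have e: "{1, 3} \<in> edges ?L" by (simp add: lasso_edge_iff lasso_adj_def)
  show ?thesis
  proof (rule dern_eq_1[OF L e])
    fix x y
    assume xy: "x \<in> verts ?L" "y \<in> verts ?L" "x \<noteq> y" "{x, y} \<notin> edges (del_edge ?L {1, 3})"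
      and sum: "degree (del_edge ?L {1, 3}) x + degree (del_edge ?L {1, 3}) y = edge_degree ?L {1, 3}"
    have deg: "degree (del_edge ?L {1, 3}) z =
      (if z = 0 \<or> 3 < z then 1 else if z = 3 then n + 1 else 2)" if "z \<le> 3 + n" for z
      using degree_del_edge[OF L e, of z] degree_lasso[of 3 z n] that by (auto split: if_splits)
    have "edge_degree ?L {1, 3} = n + 3"
      using edge_degree_eq[OF L e] degree_lasso[of 3 1 n] degree_lasso[of 3 3 n] by simp
    then show "{x, y} = {1, 3}"
      using xy sum deg[of x] deg[of y] assms
      by (auto simp: lasso_edge_iff lasso_adj_def doubleton_eq_iff split: if_splits)
  qed
qed

text \<open>Once a leaf edge at \<open>k\<close> is deleted, the required sum is
  \<open>n + 1 \<ge> 6\<close>, while two vertices other than \<open>k\<close> reach at most 3 + 2.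
  So \<open>k\<close> is an end, and its partner has degree 0: the detached leaf.\<close>

lemma dern_lasso_many_leaves:
  assumes "3 \<le> k" "5 \<le> n"
  shows "dern (lasso k n) = 1"
proof -
  let ?L = "lasso k n" and ?e = "{k, k + 1}"
  have L: "simple_graph ?L" using assms by (simp add: simple_graph_lasso)
  have e: "?e \<in> edges ?L" using assms by (simp add: lasso_edge_iff lasso_adj_def)
  show ?thesis
  proof (rule dern_eq_1[OF L e])
    fix x y
    assume xy: "x \<in> verts ?L" "y \<in> verts ?L" "x \<noteq> y"
      and sum: "degree (del_edge ?L ?e) x + degree (del_edge ?L ?e) y = edge_degree ?L ?e"
    have deg: "degree (del_edge ?L ?e) z =
      (if z = k + 1 then 0 else if z = 0 \<or> k < z then 1 else if z = 1 then 3
       else if z = k then n + 1 else 2)" if "z \<le> k + n" for z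
    proof -
      have "degree (del_edge ?L ?e) z = degree ?L z - (if z = k \<or> z = k + 1 then 1 else 0)"
        using degree_del_edge[OF L e, of z] by linarith
      then show ?thesis using degree_lasso[OF assms(1) that] assms(1) by simp
    qed
    have "edge_degree ?L ?e = n + 1"
      using edge_degree_eq[OF L e] degree_lasso[of k k n] degree_lasso[of k "k + 1" n] assms by simp
    then show "{x, y} = ?e"
      using xy sum deg[of x] deg[of y] assms by (auto split: if_splits)
  qed
qed

text \<open>
  Chosen so that, when \<open>k \<ge> 4\<close> and \<open>n \<le> 4\<close>, every card of \<open>lasso k n\<close> has a completion violating
  one of these conditions.
\<close>

definition lasso_like :: "'a ugraph \<Rightarrow> bool" where
  "lasso_like G \<longleftrightarrow>
     (\<forall>x\<in>verts G. degree G x \<noteq> 0) \<and>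
     (\<forall>x y z. \<not> ({x, y} \<in> edges G \<and> {y, z} \<in> edges G \<and> {x, z} \<in> edges G)) \<and>
     (\<forall>x y. {x, y} \<in> edges G \<and> degree G x = 1 \<longrightarrow> 3 \<le> degree G y) \<and>
     (\<forall>x\<in>verts G. \<forall>y\<in>verts G. x \<noteq> y \<and> 3 \<le> degree G x \<and> 3 \<le> degree G y \<longrightarrow> {x, y} \<in> edges G)"

section \<open>An invariant separating lassos from other completions\<close>

text \<open>All four conditions speak only of adjacency and degrees. Used contrapositively: a
  completion that violates one of them is not a lasso.\<close>

lemma lasso_like_isomorphic:
  assumes "simple_graph G" "lasso_like H" "G \<cong>\<^sub>g H"
  shows "lasso_like G"
proof -
  obtain f where f: "bij_betw f (verts G) (verts H)" "(`) f ` edges G = edges H"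
    using assms(3) by (auto simp: isomorphic_def)
  note deg = isomorphic_degree[OF assms(1) f]
  note edge = isomorphic_edge_iff[OF assms(1) f]
  note V = simple_graph_edgeD[OF assms(1)]
  have im: "f x \<in> verts H" if "x \<in> verts G" for x using that f(1) by (auto simp: bij_betw_def)
  have inj: "f x \<noteq> f y" if "x \<in> verts G" "y \<in> verts G" "x \<noteq> y" for x y
    using that f(1) by (auto simp: bij_betw_def inj_on_def)
  have no_isolated: "\<forall>x\<in>verts H. degree H x \<noteq> 0"
    and no_triangle: "\<forall>x y z. \<not> ({x, y} \<in> edges H \<and> {y, z} \<in> edges H \<and> {x, z} \<in> edges H)"
    and leaf: "\<forall>x y. {x, y} \<in> edges H \<and> degree H x = 1 \<longrightarrow> 3 \<le> degree H y"
    and clique: "\<forall>x\<in>verts H. \<forall>y\<in>verts H.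
      x \<noteq> y \<and> 3 \<le> degree H x \<and> 3 \<le> degree H y \<longrightarrow> {x, y} \<in> edges H"
    using assms(2) unfolding lasso_like_def by blast+
  show ?thesis
    unfolding lasso_like_def
  proof (intro conjI allI ballI impI notI; (elim conjE)?)
    fix x assume "x \<in> verts G" "degree G x = 0"
    then show False using no_isolated[rule_format, of "f x"] deg[of x] im[of x] by simp
  next
    fix x y z assume "{x, y} \<in> edges G" "{y, z} \<in> edges G" "{x, z} \<in> edges G"
    moreover from this have "x \<in> verts G" "y \<in> verts G" "z \<in> verts G" using V by blast+
    ultimately show False
      using no_triangle[rule_format, of "f x" "f y" "f z"] edge[of x y] edge[of y z] edge[of x z] by simp
  next
    fix x y assume "{x, y} \<in> edges G" "degree G x = 1"
    moreover from this have "x \<in> verts G" "y \<in> verts G" using V by blast+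
    ultimately show "3 \<le> degree G y"
      using leaf[rule_format, of "f x" "f y"] edge[of x y] deg[of x] deg[of y] by simp
  next
    fix x y assume "x \<in> verts G" "y \<in> verts G" "x \<noteq> y" "3 \<le> degree G x" "3 \<le> degree G y"
    then show "{x, y} \<in> edges G"
      using clique[rule_format, of "f x" "f y"] deg[of x] deg[of y] im[of x] im[of y] inj[of x y] edge[of x y] by simp
  qed
qed

text \<open>The only cycle has \<open>k \<ge> 4\<close> vertices, so there is no triangle. Leaves
  hang at the hubs 1 and \<open>k\<close>, which are adjacent and are the only vertices of degree at
  least 3.\<close>

lemma lasso_like_lasso:
  assumes "4 \<le> k" "1 \<le> n"
  shows "lasso_like (lasso k n)"
proof -
  have deg: "degree (lasso k n) x =
    (if x = 0 \<or> k < x then 1 else if x = 1 then 3 else if x = k then n + 2 else 2)"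
    if "x \<le> k + n" for x
    using degree_lasso[of k x n] that assms by simp
  have V: "x \<le> k + n" "y \<le> k + n" if "{x, y} \<in> edges (lasso k n)" for x y
    using simple_graph_edgeD[OF simple_graph_lasso that] assms by auto
  show ?thesis
    unfolding lasso_like_def
  proof (intro conjI allI ballI impI notI; (elim conjE)?)
    fix x y z
    assume "{x, y} \<in> edges (lasso k n)" "{y, z} \<in> edges (lasso k n)" "{x, z} \<in> edges (lasso k n)"
    then show False using assms by (auto simp: lasso_edge_iff lasso_adj_def)
  next
    fix x y assume xy: "{x, y} \<in> edges (lasso k n)" "degree (lasso k n) x = 1"
    have "degree (lasso k n) x \<noteq> 1" if "\<not> (x = 0 \<or> k < x)"
      unfolding deg[OF V(1)[OF xy(1)]] using that by simp
    then have "x = 0 \<or> k < x" using xy(2) by blast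
    moreover have "lasso_adj k n x y \<or> lasso_adj k n y x" using xy(1) by (simp add: lasso_edge_iff)
    ultimately have "y = 1 \<or> y = k" using assms by (auto simp: lasso_adj_def)
    then show "3 \<le> degree (lasso k n) y" using deg[of y] assms by auto
  next
    have hub: "x = 1 \<or> x = k" if "x \<in> verts (lasso k n)" "3 \<le> degree (lasso k n) x" for x
      using that deg[of x] by (auto split: if_splits)
    fix x y assume "x \<in> verts (lasso k n)" "y \<in> verts (lasso k n)" "x \<noteq> y"
      "3 \<le> degree (lasso k n) x" "3 \<le> degree (lasso k n) y"
    then show "{x, y} \<in> edges (lasso k n)"
      using hub[of x] hub[of y] by (auto simp: lasso_edge_iff lasso_adj_def)
  qed (use deg in \<open>auto split: if_splits\<close>)
qed

text \<open>Restates the degree condition with degrees before deletion and after insertion: both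
  sides exceed the sums in the edge-deleted graph by 2, so the equation is equivalent and can be
  computed by \<open>degree_replace_edge\<close>.\<close>

lemma lasso_replace_edge:
  assumes "4 \<le> k" "1 \<le> n" "{p, q} \<in> edges (lasso k n)"
    and "x \<le> k + n" "y \<le> k + n" "x \<noteq> y" "{x, y} \<notin> edges (lasso k n)"
  defines "K \<equiv> add_edge (del_edge (lasso k n) {p, q}) {x, y}"
  assumes deg: "degree K x + degree K y = degree (lasso k n) p + degree (lasso k n) q"
    and "\<not> lasso_like K"
  shows "\<exists>x\<in>verts (lasso k n). \<exists>y\<in>verts (lasso k n). x \<noteq> y \<and> {x, y} \<notin> edges (lasso k n) \<and>
      degree (del_edge (lasso k n) {p, q}) x + degree (del_edge (lasso k n) {p, q}) y =
        edge_degree (lasso k n) {p, q} \<and>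
      \<not> add_edge (del_edge (lasso k n) {p, q}) {x, y} \<cong>\<^sub>g lasso k n"
proof -
  let ?D = "del_edge (lasso k n) {p, q}"
  have L: "simple_graph (lasso k n)" using assms(1) by (simp add: simple_graph_lasso)
  note D = simple_graph_del_edge[OF L, of "{p, q}"]
  have "degree ?D x + degree ?D y = edge_degree (lasso k n) {p, q}"
    using degree_add_edge[OF D, of x y x] degree_add_edge[OF D, of x y y] assms(6,7) deg
      edge_degree_eq[OF L assms(3)] by (simp add: K_def)
  moreover have "simple_graph K"
    unfolding K_def using assms(4-6) by (intro simple_graph_add_edge D) auto
  then have "\<not> K \<cong>\<^sub>g lasso k n"
    using lasso_like_isomorphic[OF _ lasso_like_lasso[OF assms(1,2)]] assms(10) by blast
  ultimately show ?thesis
    using assms(4-7) unfolding K_def by (intro bexI[of _ x] bexI[of _ y]) auto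
qed

section \<open>Second completions of every card when \<open>4 \<le> k\<close> and
  \<open>n \<le> 4\<close>\<close>

lemma dern_lasso_ge_2:
  assumes "4 \<le> k" "1 \<le> n" "n \<le> 4"
  shows "2 \<le> dern (lasso k n)"
proof (rule dern_ge_2)
  let ?L = "lasso k n"
  show L: "simple_graph ?L" using assms by (simp add: simple_graph_lasso)
  fix e assume "e \<in> edges ?L"
  then obtain p q where e: "e = {p, q}" and pq: "lasso_adj k n p q" by (auto simp: lasso_def)
  have pqE: "{p, q} \<in> edges ?L" using pq lasso_edge_iff by blast
  note deg = degree_replace_edge simple_graph_lasso degree_lasso
  let ?goal = "\<exists>x\<in>verts ?L. \<exists>y\<in>verts ?L. x \<noteq> y \<and> {x, y} \<notin> edges ?L \<and>
      degree (del_edge ?L {p, q}) x + degree (del_edge ?L {p, q}) y = edge_degree ?L {p, q} \<and>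
      \<not> add_edge (del_edge ?L {p, q}) {x, y} \<cong>\<^sub>g ?L"
  have replace: ?goal
    if "x \<le> k + n" "y \<le> k + n" "x \<noteq> y" "{x, y} \<notin> edges ?L"
      "degree (add_edge (del_edge ?L {p, q}) {x, y}) x + degree (add_edge (del_edge ?L {p, q}) {x, y}) y
       = degree ?L p + degree ?L q"
      "\<not> lasso_like (add_edge (del_edge ?L {p, q}) {x, y})" for x y
    using lasso_replace_edge[OF assms(1,2) pqE that] .
  have isolated: "\<not> lasso_like K" if "z \<in> verts K" "degree K z = 0" for K :: "nat ugraph" and z
    using that unfolding lasso_like_def by blast
  have triangle: "\<not> lasso_like K" if "{a, b} \<in> edges K" "{b, c} \<in> edges K" "{a, c} \<in> edges K"
    for K :: "nat ugraph" and a b c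
    using that unfolding lasso_like_def by blast
  have leaf: "\<not> lasso_like K" if "{a, b} \<in> edges K" "degree K a = 1" "degree K b = 2"
    for K :: "nat ugraph" and a b
  proof
    assume "lasso_like K"
    then have "3 \<le> degree K b" using that(1,2) unfolding lasso_like_def by blast
    then show False using that(3) by simp
  qed
  have far: "\<not> lasso_like K" if "a \<in> verts K" "b \<in> verts K" "a \<noteq> b" "{a, b} \<notin> edges K"
    "3 \<le> degree K a" "3 \<le> degree K b" for K :: "nat ugraph" and a b
    using that unfolding lasso_like_def by blast
  note adj = lasso_edge_iff lasso_adj_def doubleton_eq_iff
  \<comment> \<open>A leaf edge at \<open>k\<close> is replaced by a pair that avoids
    \<open>k\<close> and has sum \<open>n + 1\<close> in the card; the choice depends on
    \<open>n\<close>, whence the last four cases.\<close>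
  consider "p = 1" "q = k" | "p = 0" "q = 1" | "p = 1" "q = 2" | "2 \<le> p" "p + 2 = k" "q = p + 1"
    | "2 \<le> p" "p + 2 < k" "q = p + 1" | "p + 1 = k" "q = k"
    | "p = k" "k < q" "q \<le> k + n" "n = 1" | "p = k" "k < q" "q \<le> k + n" "n = 2"
    | "p = k" "k < q" "q \<le> k + n" "n = 3" | "p = k" "k < q" "q \<le> k + n" "n = 4"
  proof -
    consider (hub) "p = 1" "q = k" | (path) "p < k" "q = p + 1" | (leaf) "p = k" "k < q" "q \<le> k + n"
      using pq unfolding lasso_adj_def by blast
    then show thesis
    proof cases
      case path
      then consider "p = 0" | "p = 1" | "2 \<le> p" "p + 2 = k" | "2 \<le> p" "p + 2 < k" | "p + 1 = k"
        by linarith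
      then show thesis by cases (use path that in auto)
    next
      case leaf
      consider "n = 1" | "n = 2" | "n = 3" | "n = 4" using assms by linarith
      then show thesis by cases (use leaf that in auto)
    qed (use that in auto)
  qed
  then have ?goal
  proof cases
    \<comment> \<open>Moving the hub edge from 1 to 2 leaves 0 as a leaf at the vertex 1 of degree
      2.\<close>
    case 1
    have ne: "{k, 2} \<notin> edges ?L" using assms by (auto simp: adj)
    show ?thesis
      by (rule replace[of k 2]; (rule leaf[of 0 1])?)
        (use 1 assms ne in \<open>auto simp: deg adj\<close>)
  next
    \<comment> \<open>Moving the leaf 0 to 2 makes 2 and \<open>k\<close> nonadjacent vertices of
      degree at least 3.\<close>
    case 2
    have ne: "{0, 2} \<notin> edges ?L" using assms by (auto simp: adj)
    show ?thesis
      by (rule replace[of 0 2]; (rule far[of 2 _ k])?)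
        (use 2 assms ne in \<open>auto simp: deg adj\<close>)
  next
    \<comment> \<open>Joining a leaf at \<open>k\<close> to the other hub closes a triangle.\<close>
    case 3
    have ne: "{k + 1, 1} \<notin> edges ?L" using assms by (auto simp: adj)
    show ?thesis
      by (rule replace[of "k + 1" 1]; (rule triangle[of 1 k _ "k + 1"])?)
        (use 3 assms ne in \<open>auto simp: deg adj\<close>)
  next
    \<comment> \<open>Here \<open>q = k - 1\<close> is a neighbour of \<open>k\<close>, so joining
      it to a leaf at \<open>k\<close> closes a triangle.\<close>
    case 4
    have ne: "{k + 1, q} \<notin> edges ?L" using 4 assms by (auto simp: adj)
    show ?thesis
      by (rule replace[of "k + 1" q]; (rule triangle[of q k _ "k + 1"])?)
        (use 4 assms ne in \<open>auto simp: deg adj\<close>)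
  next
    \<comment> \<open>Cutting the path makes \<open>q\<close> a leaf; \<open>p + 2 < k\<close>
      ensures that its neighbour \<open>q + 1\<close> is not a hub and has degree 2.\<close>
    case 5
    have ne: "{0, p} \<notin> edges ?L" using 5 assms by (auto simp: adj)
    show ?thesis
      by (rule replace[of 0 p]; (rule leaf[of q "q + 1"])?)
        (use 5 assms ne in \<open>auto simp: deg adj\<close>)
  next
    \<comment> \<open>The hub edge together with 0 forms a triangle.\<close>
    case 6
    have ne: "{0, k} \<notin> edges ?L" using 6 assms by (auto simp: adj)
    show ?thesis
      by (rule replace[of 0 k]; (rule triangle[of 0 1 _ k])?)
        (use 6 assms ne in \<open>auto simp: deg adj\<close>)
  next
    \<comment> \<open>The single leaf at \<open>k\<close> moves to 3, which is not adjacent to 1.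
      Moving it to 2 would only reproduce a lasso.\<close>
    case 7
    have ne: "{q, 3} \<notin> edges ?L" using 7 assms by (auto simp: adj)
    show ?thesis
      by (rule replace[of q 3]; (rule far[of 1 _ 3])?)
        (use 7 assms ne in \<open>auto simp: deg adj\<close>)
  next
    \<comment> \<open>Required sum 3 = 1 + 2, from the leaf 0 and the path vertex 2;
      \<open>q\<close> stays isolated.\<close>
    case 8
    have ne: "{0, 2} \<notin> edges ?L" using 8 assms by (auto simp: adj)
    show ?thesis
      by (rule replace[of 0 2]; (rule isolated[of q])?)
        (use 8 assms ne in \<open>auto simp: deg adj\<close>)
  next
    \<comment> \<open>Required sum 4 = 1 + 3, from a remaining leaf \<open>r\<close> at
      \<open>k\<close> and the hub 1; \<open>q\<close> stays isolated.\<close>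
    case 9
    define r where "r = (if q = k + 1 then k + 2 else k + 1)"
    have r: "k < r" "r \<le> k + n" "r \<noteq> q" using 9 by (auto simp: r_def)
    have ne: "{r, 1} \<notin> edges ?L" using 9 assms r by (auto simp: adj)
    show ?thesis
      by (rule replace[of r 1]; (rule isolated[of q])?)
        (use 9 assms ne r in \<open>auto simp: deg adj\<close>)
  next
    \<comment> \<open>Required sum 5 = 3 + 2, the largest available away from \<open>k\<close>; 3 is
      a path vertex not adjacent to 1 because \<open>4 \<le> k\<close>.\<close>
    case 10
    have ne: "{1, 3} \<notin> edges ?L" using 10 assms by (auto simp: adj)
    show ?thesis
      by (rule replace[of 1 3]; (rule isolated[of q])?)
        (use 10 assms ne in \<open>auto simp: deg adj\<close>)
  qed
  then show "\<exists>x\<in>verts ?L. \<exists>y\<in>verts ?L. x \<noteq> y \<and> {x, y} \<notin> edges ?L \<and>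
      degree (del_edge ?L e) x + degree (del_edge ?L e) y = edge_degree ?L e \<and>
      \<not> add_edge (del_edge ?L e) {x, y} \<cong>\<^sub>g ?L"
    using e by simp
qed

section \<open>Two cards determine a lasso\<close>

text \<open>The graph without the leaf edge \<open>{0, 1}\<close> has an isolated vertex, and each
  of its leaves has a neighbour of degree at least 3. For a completion \<open>?H\<close> of the
  hub-edge card to yield this by deleting \<open>f\<close>, \<open>f\<close> must cut off a leaf
  from a vertex of degree 3, and the leaves at the other hub force large degree there. Both demands
  are met only by the original hub edge.\<close>

lemma dern_lasso_le_2:
  assumes "4 \<le> k" "1 \<le> n"
  shows "dern (lasso k n) \<le> 2"
proof -
  let ?L = "lasso k n"
  have k: "3 \<le> k" using assms by simp
  have L: "simple_graph ?L" using k by (rule simple_graph_lasso)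
  have hub: "{1, k} \<in> edges ?L" and leaf: "{0, 1} \<in> edges ?L"
    using assms by (auto simp: lasso_edge_iff lasso_adj_def)
  let ?D = "del_edge ?L {1, k}" and ?C = "del_edge ?L {0, 1}"
  have D: "simple_graph ?D" and C: "simple_graph ?C" using L by (auto intro: simple_graph_del_edge)
  have degD: "degree ?D z = (if z = 0 \<or> k < z then 1 else if z = k then n + 1 else 2)"
    if "z \<le> k + n" for z
  proof -
    have "degree ?D z = degree ?L z - (if z = 1 \<or> z = k then 1 else 0)"
      using degree_del_edge[OF L hub, of z] by linarith
    then show ?thesis using degree_lasso[OF k that] k by simp
  qed
  have degC: "degree ?C z = (if z = 0 then 0 else if k < z then 1 else if z = k then n + 2 else 2)"
    if "z \<le> k + n" for z
  proof -
    have "degree ?C z = degree ?L z - (if z = 0 \<or> z = 1 then 1 else 0)"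
      using degree_del_edge[OF L leaf, of z] by linarith
    then show ?thesis using degree_lasso[OF k that] k by simp
  qed
  have leafC: "3 \<le> degree ?C b" if ab: "{a, b} \<in> edges ?C" "degree ?C a = 1" for a b
  proof -
    have V: "a \<le> k + n" "b \<le> k + n" using simple_graph_edgeD[OF C ab(1)] by auto
    have "degree ?C a \<noteq> 1" if "\<not> k < a" unfolding degC[OF V(1)] using that assms by simp
    then have "k < a" using ab(2) by blast
    then have "b = k" using ab(1) k by (auto simp: lasso_edge_iff lasso_adj_def)
    then show ?thesis using degC[of k] assms by simp
  qed
  show ?thesis
  proof (rule dern_le_2[OF L hub leaf])
    show "{1, k} \<noteq> {0, 1}" using k by (auto simp: doubleton_eq_iff)
    fix x y f
    let ?H = "add_edge ?D {x, y}"
    assume xy: "x \<in> verts ?L" "y \<in> verts ?L" "x \<noteq> y" "{x, y} \<notin> edges ?D"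
      and sum: "degree ?D x + degree ?D y = edge_degree ?L {1, k}"
      and f: "f \<in> edges ?H" "edge_degree ?H f = edge_degree ?L {0, 1}"
      and iso: "?C \<cong>\<^sub>g del_edge ?H f"
    let ?F = "del_edge ?H f"
    have H: "simple_graph ?H" using xy by (intro simple_graph_add_edge D) auto
    have F: "simple_graph ?F" by (rule simple_graph_del_edge[OF H])
    have degH: "degree ?H z = degree ?D z + (if z = x \<or> z = y then 1 else 0)" for z
      using degree_add_edge[OF D xy(4,3)] .
    have degxy: "degree ?D x + degree ?D y = n + 3"
      using sum edge_degree_eq[OF L hub] degree_lasso[OF k, of 1 n] degree_lasso[OF k, of k n] k
      by simp
    have f2: "edge_degree ?H f = 2"
      using f(2) edge_degree_eq[OF L leaf] degree_lasso[OF k, of 0 n] degree_lasso[OF k, of 1 n] k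
      by simp
    have xyd: "degree ?D x \<le> n + 1" "degree ?D y \<le> n + 1"
      using degD[of x] degD[of y] xy(1,2) assms by auto
    have inH: "z = x \<or> z = y" if "degree ?D z < degree ?H z" for z
      using that degH[of z] by (auto split: if_splits)
    have d1: "degree ?D 1 = 2" and dk: "degree ?D k = n + 1" using degD[of 1] degD[of k] k by simp_all
    \<comment> \<open>The partner of a leaf would need degree \<open>n + 2\<close>, but no degree
      exceeds \<open>n + 1\<close>.\<close>
    have noleaf: "z \<noteq> x \<and> z \<noteq> y" if "degree ?D z = 1" for z
      using that degxy xyd by auto
    \<comment> \<open>With 1 as one end, the other has degree \<open>n + 1\<close>. For
      \<open>n > 1\<close> only \<open>k\<close> qualifies; for \<open>n = 1\<close> this is the
      degree 2 shared by the inner path vertices, so \<open>k\<close> has to be supplied.\<close>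
    have hubs: "{x, y} = {1, k}" if "1 = x \<or> 1 = y" "n = 1 \<Longrightarrow> k = x \<or> k = y"
    proof (cases "n = 1")
      case True
      then show ?thesis using that k by auto
    next
      case False
      have unique: "z = k" if "degree ?D z = n + 1" "z \<le> k + n" for z
      proof (rule ccontr)
        assume "z \<noteq> k"
        then have "degree ?D z \<noteq> n + 1" unfolding degD[OF that(2)] using False assms by simp
        then show False using that(1) by simp
      qed
      show ?thesis
        using d1 that(1) unique[of x] unique[of y] degxy xy(1,2) by auto
    qed
    have leafF: "3 \<le> degree ?F b" if ab: "{a, b} \<in> edges ?F" "degree ?F a = 1" for a b
    proof -
      obtain g where g: "bij_betw g (verts ?F) (verts ?C)" "(`) g ` edges ?F = edges ?C"
        using isomorphic_sym[OF C iso] by (auto simp: isomorphic_def)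
      have V: "a \<in> verts ?F" "b \<in> verts ?F" using simple_graph_edgeD[OF F ab(1)] by auto
      show ?thesis
        using leafC[of "g a" "g b"] isomorphic_edge_iff[OF F g V] ab
          isomorphic_degree[OF F g V(1)] isomorphic_degree[OF F g V(2)] by simp
    qed
    obtain z where z: "z \<le> k + n" "degree ?F z = 0"
    proof -
      obtain g where g: "bij_betw g (verts ?C) (verts ?F)" "(`) g ` edges ?C = edges ?F"
        using iso by (auto simp: isomorphic_def)
      have "g 0 \<in> verts ?F" using g(1) by (auto simp: bij_betw_def)
      then show thesis
        using that[of "g 0"] isomorphic_degree[OF C g, of 0] degC[of 0] by simp
    qed
    obtain p q where pq: "f = {p, q}" using simple_graph_edgeE[OF H f(1)] by metis
    have degF: "degree ?H w = degree ?F w + (if w \<in> f then 1 else 0)" for w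
      using degree_del_edge[OF H, of p q w] f(1) unfolding pq by simp
    \<comment> \<open>No vertex is isolated in \<open>?D\<close>, so \<open>z\<close> lost its only
      edge through \<open>f\<close>: it is a leaf of \<open>?D\<close> on \<open>f\<close> and not
      an end of the added edge.\<close>
    have "degree ?D z \<ge> 1" using degD[OF z(1)] assms by simp
    then have zf: "z \<in> f" and z1: "degree ?D z = 1" "z \<noteq> x" "z \<noteq> y"
      using degF[of z] degH[of z] z(2) by (auto split: if_splits)
    obtain w where w: "f = {z, w}" "w \<noteq> z"
      using zf simple_graph_edgeD(3)[OF H, of p q] f(1) unfolding pq by fastforce
    have zw: "{z, w} \<in> edges ?D" using f(1) w z1 by (auto simp: doubleton_eq_iff)
    have "degree ?F z + degree ?F w = 2"
      using edge_degree_del_edge[OF H, of z w] f(1) w f2 by simp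
    then have w3: "degree ?H w = 3" using z(2) degF[of w] w by simp
    \<comment> \<open>A leaf off \<open>f\<close> survives in \<open>?F\<close>, whose leaves have
      neighbours of degree at least 3.\<close>
    have other: "3 \<le> degree ?H b" if "degree ?D a = 1" "{a, b} \<in> edges ?D" "a \<notin> f" for a b
    proof -
      have a: "degree ?F a = 1" using that degF[of a] degH[of a] noleaf[OF that(1)] by simp
      have "{a, b} \<in> edges ?F" using that by auto
      from leafF[OF this a] degF[of b] show ?thesis by linarith
    qed
    have "z = 0 \<or> k < z" 
    proof (rule ccontr)
      assume "\<not> ?thesis"
      then have "degree ?D z \<noteq> 1" unfolding degD[OF z(1)] using assms by simp
      then show False using z1(1) by simp
    qed
    then show "{x, y} = {1, k}"
    proof
      assume "z = 0"
      then have "w = 1" using zw k by (auto simp: lasso_edge_iff lasso_adj_def)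
      \<comment> \<open>The vertex 1 gained an edge, since its degree rose from 2 to 3. The leaf
        \<open>k + 1\<close> controls \<open>k\<close>, whose degree in \<open>?D\<close> is only 2
        when \<open>n = 1\<close>.\<close>
      have "3 \<le> degree ?H k"
      proof (rule other)
        show "degree ?D (k + 1) = 1" using degD[of "k + 1"] assms by simp
        show "{k + 1, k} \<in> edges ?D" using assms
          by (auto simp: lasso_edge_iff lasso_adj_def doubleton_eq_iff)
        show "k + 1 \<notin> f" using w \<open>z = 0\<close> \<open>w = 1\<close> k by simp
      qed
      then show ?thesis
        using inH[of 1] inH[of k] w3 d1 dk \<open>w = 1\<close> by (intro hubs) auto
    next
      assume "k < z"
      then have "w = k" using zw k by (auto simp: lasso_edge_iff lasso_adj_def doubleton_eq_iff)
      \<comment> \<open>The roles are exchanged: the leaf 0 forces the degree of 1 up from 2, and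
        for \<open>n = 1\<close> the degree 3 of \<open>w = k\<close> shows that \<open>k\<close>
        gained an edge too.\<close>
      have "3 \<le> degree ?H 1"
      proof (rule other)
        show "degree ?D 0 = 1" using degD[of 0] by simp
        show "{0, 1} \<in> edges ?D" using leaf k by (auto simp: doubleton_eq_iff)
        show "0 \<notin> f" using w \<open>k < z\<close> \<open>w = k\<close> k by simp
      qed
      then show ?thesis
        using inH[of 1] inH[of k] w3 d1 dk \<open>w = k\<close> by (intro hubs) auto
    qed
  qed
qed

lemma dern_lasso:
  assumes "3 \<le> k" "1 \<le> n"
  shows "dern (lasso k n) = (if 3 < k \<and> n \<le> 4 then 2 else 1)"
proof -
  consider "4 \<le> k" "n \<le> 4" | "k = 3" | "5 \<le> n" using assms by linarith
  then show ?thesis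
  proof cases
    case 1
    then have "dern (lasso k n) = 2"
      using dern_lasso_le_2[of k n] dern_lasso_ge_2[of k n] assms by (intro antisym) auto
    then show ?thesis using 1 by simp
  next
    case 2
    then show ?thesis using dern_lasso_3 assms by simp
  next
    case 3
    then show ?thesis using dern_lasso_many_leaves assms by simp
  qed
qed

section \<open>Double brooms\<close>

lemma path_vertex_simps [simp]:
  "path_vertex k i j p = Inner a b c \<longleftrightarrow> i = a \<and> j = b \<and> p = c \<and> p \<noteq> 0 \<and> p + 1 \<noteq> k i"
  "path_vertex k i j p \<noteq> LeafU l" "path_vertex k i j p \<noteq> LeafV l"
  "path_vertex k i j 0 = HubU"
  by (auto simp: path_vertex_def)

fun swap_vertex :: "(nat \<Rightarrow> nat) \<Rightarrow> broom_vertex \<Rightarrow> broom_vertex" where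
  "swap_vertex k HubU = HubV"
| "swap_vertex k HubV = HubU"
| "swap_vertex k (LeafU l) = LeafV l"
| "swap_vertex k (LeafV l) = LeafU l"
| "swap_vertex k (Inner i j p) = Inner i j (k i - 1 - p)"

lemma swap_path_vertex:
  assumes "2 \<le> k i" "p < k i"
  shows "swap_vertex k (path_vertex k i j p) = path_vertex k i j (k i - 1 - p)"
  using assms by (auto simp: path_vertex_def)

lemma path_vertex_in_broom:
  "i \<in> {1..t} \<Longrightarrow> j < m i \<Longrightarrow> p < k i \<Longrightarrow> path_vertex k i j p \<in> verts (broom n1 n2 t m k)"
  unfolding broom_def by auto

lemma path_edge_in_broom:
  "i \<in> {1..t} \<Longrightarrow> j < m i \<Longrightarrow> p + 1 < k i \<Longrightarrow>
    {path_vertex k i j p, path_vertex k i j (p + 1)} \<in> edges (broom n1 n2 t m k)"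
  unfolding broom_def by auto

lemma swap_broom_vertex:
  assumes "\<forall>i\<in>{1..t}. 2 \<le> k i" "x \<in> verts (broom n1 n2 t m k)"
  shows "swap_vertex k x \<in> verts (broom n2 n1 t m k)" "swap_vertex k (swap_vertex k x) = x"
proof -
  from assms(2) consider (path) i j p where "x = path_vertex k i j p" "i \<in> {1..t}" "j < m i" "p < k i"
    | (U) l where "x = LeafU l" "l < n1" | (V) l where "x = LeafV l" "l < n2"
    by (auto simp: broom_def)
  then have "swap_vertex k x \<in> verts (broom n2 n1 t m k) \<and> swap_vertex k (swap_vertex k x) = x"
  proof cases
    case path
    have k: "2 \<le> k i" using assms(1) path by blast
    have "path_vertex k i j (k i - 1 - p) \<in> verts (broom n2 n1 t m k)"
      using path k by (intro path_vertex_in_broom) auto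
    then show ?thesis
      using path swap_path_vertex[of k i p j] swap_path_vertex[of k i "k i - 1 - p" j] k by simp
  qed (auto simp: broom_def)
  then show "swap_vertex k x \<in> verts (broom n2 n1 t m k)" "swap_vertex k (swap_vertex k x) = x"
    by auto
qed

lemma swap_broom_edge:
  assumes "\<forall>i\<in>{1..t}. 2 \<le> k i" "e \<in> edges (broom n1 n2 t m k)"
  shows "swap_vertex k ` e \<in> edges (broom n2 n1 t m k)"
proof -
  from assms(2) consider
      (path) i j p where "e = {path_vertex k i j p, path_vertex k i j (p + 1)}" "i \<in> {1..t}" "j < m i"
        "p + 1 < k i"
    | (U) l where "e = {HubU, LeafU l}" "l < n1" | (V) l where "e = {HubV, LeafV l}" "l < n2"
    unfolding broom_def by auto
  then show ?thesis
  proof cases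
    case path
    have k: "2 \<le> k i" using assms(1) path by blast
    \<comment> \<open>Positions \<open>p\<close> and \<open>p + 1\<close> are reflected to
      \<open>q + 1\<close> and \<open>q\<close>.\<close>
    define q where "q = k i - 2 - p"
    have "swap_vertex k ` e = {path_vertex k i j q, path_vertex k i j (q + 1)}"
      using path k swap_path_vertex[of k i p j] swap_path_vertex[of k i "p + 1" j]
      by (auto simp: q_def Suc_diff_Suc numeral_2_eq_2)
    moreover have "q + 1 < k i" using path k by (simp add: q_def)
    ultimately show ?thesis using path path_edge_in_broom[of i t j m q k] by simp
  qed (auto simp: broom_def)
qed

text \<open>The hubs enter the vertex set only as ends of paths, while leaf edges contain them in
  any case; a path of positive multiplicity is what makes them vertices.\<close>

lemma broom_edge_vertex:
  assumes "\<forall>i\<in>{1..t}. 2 \<le> k i" "i \<in> {1..t}" "0 < m i" "e \<in> edges (broom n1 n2 t m k)"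
  shows "e \<subseteq> verts (broom n1 n2 t m k)"
proof -
  have "HubU = path_vertex k i 0 0" "HubV = path_vertex k i 0 (k i - 1)" "0 < k i" "k i - 1 < k i"
    using bspec[OF assms(1,2)] by (auto simp: path_vertex_def)
  then have "HubU \<in> verts (broom n1 n2 t m k)" "HubV \<in> verts (broom n1 n2 t m k)"
    using path_vertex_in_broom[of i t 0 m _ k] assms(2,3) by metis+
  moreover from assms(4) consider
      (path) i j p where "e = {path_vertex k i j p, path_vertex k i j (p + 1)}" "i \<in> {1..t}" "j < m i"
        "p + 1 < k i"
    | (U) l where "e = {HubU, LeafU l}" "l < n1" | (V) l where "e = {HubV, LeafV l}" "l < n2"
    unfolding broom_def by auto
  then have "e \<subseteq> verts (broom n1 n2 t m k) \<union> {HubU, HubV}"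
  proof cases
    case path
    then have "path_vertex k i j p \<in> verts (broom n1 n2 t m k)"
      "path_vertex k i j (p + 1) \<in> verts (broom n1 n2 t m k)"
      by (auto intro!: path_vertex_in_broom)
    then show ?thesis using path by simp
  qed (auto simp: broom_def)
  ultimately show ?thesis by auto
qed

text \<open>\<open>swap_vertex\<close> reverses every path and is its own inverse. This reduces
  \<open>n2 = 1\<close> to \<open>n1 = 1\<close>.\<close>

lemma broom_swap:
  assumes "\<forall>i\<in>{1..t}. 2 \<le> k i" "i \<in> {1..t}" "0 < m i"
  shows "broom n1 n2 t m k \<cong>\<^sub>g broom n2 n1 t m k"
  unfolding isomorphic_def
proof (intro exI conjI)
  show "bij_betw (swap_vertex k) (verts (broom n1 n2 t m k)) (verts (broom n2 n1 t m k))"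
    using swap_broom_vertex[OF assms(1)] by (intro bij_betw_byWitness[of _ "swap_vertex k"]) auto
  show "(`) (swap_vertex k) ` edges (broom n1 n2 t m k) = edges (broom n2 n1 t m k)"
  proof (intro equalityI subsetI)
    fix e assume e: "e \<in> edges (broom n2 n1 t m k)"
    have "swap_vertex k (swap_vertex k x) = x" if "x \<in> e" for x
      using broom_edge_vertex[OF assms e] swap_broom_vertex(2)[OF assms(1)] that by blast
    then have "swap_vertex k ` swap_vertex k ` e = e" by (force simp: image_image)
    then show "e \<in> (`) (swap_vertex k) ` edges (broom n1 n2 t m k)"
      using swap_broom_edge[OF assms(1) e] by (metis image_eqI)
  qed (use swap_broom_edge[OF assms(1)] in auto)
qed

section \<open>Degrees in brooms and the case of large hubs\<close>

lemma degree_broom_le: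
  assumes "x \<noteq> HubU" "x \<noteq> HubV"
  shows "degree (broom n1 n2 t m k) x \<le> 2"
proof -
  let ?N = "{y. {x, y} \<in> edges (broom n1 n2 t m k)}"
  have le: ?thesis if "?N \<subseteq> {a, b}" for a b
    using card_mono[OF _ that] unfolding degree_def by (simp add: card_insert_if split: if_splits)
  show ?thesis
  proof (cases x)
    case (LeafU l)
    then have "?N \<subseteq> {HubU, HubU}" by (auto simp: broom_def doubleton_eq_iff dest: sym)
    then show ?thesis by (rule le)
  next
    case (LeafV l)
    then have "?N \<subseteq> {HubV, HubV}" by (auto simp: broom_def doubleton_eq_iff dest: sym)
    then show ?thesis by (rule le)
  next
    case (Inner i j p)
    have "?N \<subseteq> {path_vertex k i j (p - 1), path_vertex k i j (p + 1)}"
    proof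
      fix y assume "y \<in> ?N"
      then obtain i' j' p' where "{x, y} = {path_vertex k i' j' p', path_vertex k i' j' (p' + 1)}"
        unfolding broom_def using Inner by (auto simp: doubleton_eq_iff)
      then show "y \<in> {path_vertex k i j (p - 1), path_vertex k i j (p + 1)}"
        using Inner by (auto simp: doubleton_eq_iff dest!: sym[of "Inner _ _ _"])
    qed
    then show ?thesis by (rule le)
  qed (use assms in auto)
qed

text \<open>Choosing one inner vertex on each path with index at least 2 counts these paths.\<close>

lemma card_inner:
  "card ((\<lambda>(i, j). Inner i j (p i)) ` (SIGMA i:{2..t}. {..<m i})) = (\<Sum>i=2..t. m i)"
  by (subst card_image) (auto simp: inj_on_def)

lemma degree_broom_hub_ge:
  assumes "simple_graph (broom n1 n2 t m k)" "\<forall>i\<in>{2..t}. 3 \<le> k i"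
  defines "D \<equiv> del_edge (broom n1 n2 t m k) {HubU, HubV}"
  shows "n1 + (\<Sum>i=2..t. m i) \<le> degree D HubU" "n2 + (\<Sum>i=2..t. m i) \<le> degree D HubV"
proof -
  have fin: "finite {y. {x, y} \<in> edges D}" for x
    unfolding D_def by (intro simple_graph_finite_nbrs simple_graph_del_edge assms(1))
  have path: "{path_vertex k i j p, path_vertex k i j (p + 1)} \<in> edges (broom n1 n2 t m k)"
    if "i \<in> {2..t}" "j < m i" "p + 1 < k i" for i j p
    using that by (intro path_edge_in_broom) auto
  \<comment> \<open>Position 1 is next to \<open>HubU\<close> and position \<open>k i - 2\<close>
    next to \<open>HubV\<close>; both are inner because \<open>3 \<le> k i\<close>.\<close>
  let ?I = "\<lambda>p. (\<lambda>(i, j). Inner i j (p i)) ` (SIGMA i:{2..t}. {..<m i})"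
  have "{HubU, Inner i j 1} \<in> edges D" if "i \<in> {2..t}" "j < m i" for i j
    using path[OF that, of 0] bspec[OF assms(2) that(1)]
    unfolding D_def by (auto simp: path_vertex_def doubleton_eq_iff)
  moreover have "{HubU, LeafU l} \<in> edges D" if "l < n1" for l
    using that unfolding D_def broom_def by (auto simp: doubleton_eq_iff)
  ultimately have "LeafU ` {..<n1} \<union> ?I (\<lambda>_. 1) \<subseteq> {y. {HubU, y} \<in> edges D}" by auto
  then have "card (LeafU ` {..<n1} \<union> ?I (\<lambda>_. 1)) \<le> degree D HubU"
    unfolding degree_def by (rule card_mono[OF fin])
  moreover have "card (LeafU ` {..<n1} \<union> ?I (\<lambda>_. 1)) = card (LeafU ` {..<n1}) + card (?I (\<lambda>_. 1))"
    by (rule card_Un_disjoint) auto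
  moreover have "card (LeafU ` {..<n1}) = n1" by (simp add: card_image inj_on_def)
  ultimately show "n1 + (\<Sum>i=2..t. m i) \<le> degree D HubU" by (simp only: card_inner)
  have "{HubV, Inner i j (k i - 2)} \<in> edges D" if "i \<in> {2..t}" "j < m i" for i j
  proof -
    have ends: "path_vertex k i j (k i - 2) = Inner i j (k i - 2)"
      "path_vertex k i j (k i - 2 + 1) = HubV" "k i - 2 + 1 < k i"
      using bspec[OF assms(2) that(1)] by (auto simp: path_vertex_def)
    have "{Inner i j (k i - 2), HubV} \<in> edges (broom n1 n2 t m k)"
      using path[OF that ends(3)] unfolding ends(1,2) .
    then show ?thesis unfolding D_def by (auto simp: doubleton_eq_iff insert_commute)
  qed
  moreover have "{HubV, LeafV l} \<in> edges D" if "l < n2" for l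
    using that unfolding D_def broom_def by (auto simp: doubleton_eq_iff)
  ultimately have "LeafV ` {..<n2} \<union> ?I (\<lambda>i. k i - 2) \<subseteq> {y. {HubV, y} \<in> edges D}" by auto
  then have "card (LeafV ` {..<n2} \<union> ?I (\<lambda>i. k i - 2)) \<le> degree D HubV"
    unfolding degree_def by (rule card_mono[OF fin])
  moreover have "card (LeafV ` {..<n2} \<union> ?I (\<lambda>i. k i - 2)) = card (LeafV ` {..<n2}) + card (?I (\<lambda>i. k i - 2))"
    by (rule card_Un_disjoint) auto
  moreover have "card (LeafV ` {..<n2}) = n2" by (simp add: card_image inj_on_def)
  ultimately show "n2 + (\<Sum>i=2..t. m i) \<le> degree D HubV" by (simp only: card_inner)
qed

lemma hub_edge_broom:
  assumes "1 \<le> t" "k 1 = 2" "0 < m 1"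
  shows "{HubU, HubV} \<in> edges (broom n1 n2 t m k)"
proof -
  have "path_vertex k 1 0 0 = HubU" "path_vertex k 1 0 (0 + 1) = HubV" "0 + 1 < k 1"
    using assms(2) by (auto simp: path_vertex_def)
  then show ?thesis using path_edge_in_broom[of 1 t 0 m 0 k] assms(1,3) by simp
qed

text \<open>Without the hub edge both hubs keep degree at least 3 and all other vertices have degree
  at most 2, so replacing a hub in the pair strictly lowers the degree sum.\<close>

lemma dern_broom_large_hubs:
  assumes "simple_graph (broom n1 n2 t m k)" "\<forall>i\<in>{2..t}. 3 \<le> k i"
    and "1 \<le> t" "k 1 = 2" "0 < m 1"
    and "3 \<le> n1 + (\<Sum>i=2..t. m i)" "3 \<le> n2 + (\<Sum>i=2..t. m i)"
  shows "dern (broom n1 n2 t m k) = 1"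
proof (rule dern_eq_1[OF assms(1) hub_edge_broom[of t k m, OF assms(3-5)]])
  let ?B = "broom n1 n2 t m k"
  let ?D = "del_edge ?B {HubU, HubV}"
  note hub = hub_edge_broom[of t k m n1 n2, OF assms(3-5)]
  have U: "3 \<le> degree ?D HubU" and V: "3 \<le> degree ?D HubV"
    using degree_broom_hub_ge[OF assms(1,2)] assms(6,7) by (metis order_trans)+
  have small: "degree ?D z \<le> 2" if "z \<noteq> HubU" "z \<noteq> HubV" for z
    using degree_del_edge[OF assms(1) hub, of z] degree_broom_le[OF that, of n1 n2 t m k] by linarith
  fix x y
  assume "x \<noteq> y" "degree ?D x + degree ?D y = edge_degree ?B {HubU, HubV}"
  then have "x \<noteq> y" "degree ?D x + degree ?D y = degree ?D HubU + degree ?D HubV"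
    using edge_degree_del_edge[OF assms(1) hub] by auto
  then show "{x, y} = {HubU, HubV}"
    using U V small[of x] small[of y]
    by (cases "x = HubU"; cases "x = HubV"; cases "y = HubU"; cases "y = HubV") auto
qed

section \<open>Brooms with one further path as lassos\<close>

lemma lasso_isomorphic_broom:
  assumes "1 \<le> t" "k 1 = 2" "m 1 = 1" "i \<in> {2..t}" "m i = 1" "3 \<le> k i"
    and others: "\<And>j. j \<in> {2..t} \<Longrightarrow> j \<noteq> i \<Longrightarrow> m j = 0"
  shows "lasso (k i) n \<cong>\<^sub>g broom 1 n t m k"
proof -
  let ?K = "k i" and ?P = "path_vertex k i 0"
  \<comment> \<open>The leaf at \<open>HubU\<close> takes number 0, so path position
    \<open>p\<close> gets number \<open>p + 1\<close>; the leaves at \<open>HubV\<close>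
    follow.\<close>
  define g where "g x =
    (if x = 0 then LeafU 0 else if x \<le> ?K then ?P (x - 1) else LeafV (x - ?K - 1))" for x
  define h where "h y = (case y of LeafU l \<Rightarrow> 0 | HubU \<Rightarrow> 1 | HubV \<Rightarrow> ?K | LeafV l \<Rightarrow> ?K + 1 + l
    | Inner i j p \<Rightarrow> p + 1)" for y
  have index: "j = 1 \<or> j = i" if "j \<in> {1..t}" "0 < m j" for j
    using others[of j] that by (cases "j = 1") auto
  have i: "i \<in> {1..t}" "i \<noteq> 1" using assms(4) by auto
  have hubs: "?P 0 = HubU" "?P (?K - 1) = HubV" using assms(6) by (auto simp: path_vertex_def)
  \<comment> \<open>The path on two vertices has no inner vertices: it adds the hub edge, the chord
    \<open>{1, k i}\<close> of the lasso.\<close>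
  have p1: "path_vertex k 1 0 0 = HubU" "path_vertex k 1 0 1 = HubV"
    using assms(2) by (auto simp: path_vertex_def)
  have V: "verts (broom 1 n t m k) = ?P ` {..<?K} \<union> {LeafU 0} \<union> LeafV ` {..<n}"
  proof -
    have "{path_vertex k i j p | i j p. i \<in> {1..t} \<and> j < m i \<and> p < k i} = ?P ` {..<?K}" (is "?A = _")
    proof (intro equalityI subsetI)
      fix v assume "v \<in> ?A"
      then obtain a b p where v: "v = path_vertex k a b p" "a \<in> {1..t}" "b < m a" "p < k a" by blast
      have "a = 1 \<or> a = i" using index v by auto
      then show "v \<in> ?P ` {..<?K}"
      proof
        assume "a = 1"
        then have "v = HubU \<or> v = HubV" using v assms(2) by (auto simp: path_vertex_def)
        moreover have "?P 0 \<in> ?P ` {..<?K}" "?P (?K - 1) \<in> ?P ` {..<?K}"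
          by (rule imageI; use assms(6) in simp)+
        ultimately show ?thesis unfolding hubs by metis
      next
        assume "a = i"
        then show ?thesis using v assms(5) by auto
      qed
    next
      fix v assume "v \<in> ?P ` {..<?K}"
      then obtain p where "v = ?P p" "p < ?K" by auto
      then show "v \<in> ?A"
        using i assms(5) by (intro CollectI exI[of _ i] exI[of _ 0] exI[of _ p]) auto
    qed
    then show ?thesis unfolding broom_def by auto
  qed
  have E: "edges (broom 1 n t m k) = {{HubU, HubV}} \<union> {{?P p, ?P (p + 1)} | p. p + 1 < ?K}
      \<union> {{HubU, LeafU 0}} \<union> {{HubV, LeafV l} | l. l < n}"
  proof -
    have "{{path_vertex k i j p, path_vertex k i j (p + 1)} | i j p. i \<in> {1..t} \<and> j < m i \<and> p + 1 < k i}
      = {{HubU, HubV}} \<union> {{?P p, ?P (p + 1)} | p. p + 1 < ?K}" (is "?A = ?B")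
    proof (intro equalityI subsetI)
      fix e assume "e \<in> ?A"
      then obtain a b p where e: "e = {path_vertex k a b p, path_vertex k a b (p + 1)}"
        "a \<in> {1..t}" "b < m a" "p + 1 < k a" by blast
      have "a = 1 \<or> a = i" using index e by auto
      then show "e \<in> ?B"
      proof
        assume "a = 1"
        then have "e = {HubU, HubV}" using e p1 assms(2,3) by auto
        then show ?thesis by simp
      next
        assume "a = i"
        then show ?thesis using e assms(5) by auto
      qed
    next
      fix e assume "e \<in> ?B"
      then consider "e = {HubU, HubV}" | p where "e = {?P p, ?P (p + 1)}" "p + 1 < ?K" by blast
      then show "e \<in> ?A"
      proof cases
        case 1
        then have "e = {path_vertex k 1 0 0, path_vertex k 1 0 (0 + 1)}" "0 + 1 < k 1"
          using p1 assms(2) by simp_all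
        then show ?thesis using assms(1,3) by fastforce
      next
        case 2
        then show ?thesis using i assms(5) by fastforce
      qed
    qed
    then show ?thesis unfolding broom_def by auto
  qed
  have hP: "h (?P p) = p + 1" if "p < ?K" for p
    using that assms(6) by (auto simp: h_def path_vertex_def)
  have "bij_betw g {..?K + n} (verts (broom 1 n t m k))"
  proof (rule bij_betw_byWitness[of _ h])
    show "\<forall>x\<in>{..?K + n}. h (g x) = x"
      using hP by (auto simp: g_def) (auto simp: h_def)
    show "\<forall>y\<in>verts (broom 1 n t m k). g (h y) = y"
      using hP unfolding V by (auto simp: g_def) (auto simp: h_def)
    show "g ` {..?K + n} \<subseteq> verts (broom 1 n t m k)" unfolding V by (auto simp: g_def)
    show "h ` verts (broom 1 n t m k) \<subseteq> {..?K + n}" using hP unfolding V by auto (auto simp: h_def)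
  qed
  moreover have gP: "g (p + 1) = ?P p" if "p < ?K" for p
    using that by (auto simp: g_def)
  have g1: "g 1 = HubU" and gK: "g ?K = HubV"
    using gP[of 0] gP[of "?K - 1"] assms(6) hubs by auto
  have gL: "g (?K + 1 + l) = LeafV l" for l by (simp add: g_def)
  have g0: "g 0 = LeafU 0" by (simp add: g_def)
  have "(`) g ` edges (lasso ?K n) = edges (broom 1 n t m k)"
  proof (intro equalityI subsetI)
    fix e assume "e \<in> (`) g ` edges (lasso ?K n)"
    then obtain x y where e: "e = {g x, g y}" and xy: "lasso_adj ?K n x y"
      by (auto simp: lasso_def)
    from xy consider "x = 0" "y = 1" | p where "p + 1 < ?K" "x = p + 1" "y = p + 1 + 1"
      | l where "x = ?K" "y = ?K + 1 + l" "l < n" | "x = 1" "y = ?K"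
    proof -
      consider "x = 0" "y = 1" | "0 < x" "x < ?K" "y = x + 1" | "x = ?K" "?K < y" "y \<le> ?K + n" | "x = 1" "y = ?K"
        using xy unfolding lasso_adj_def by fastforce
      then show thesis
      proof cases
        case 2
        then show thesis using that(2)[of "x - 1"] by simp
      next
        case 3
        then show thesis using that(3)[of "y - ?K - 1"] by simp
      qed (use that in auto)
    qed
    then show "e \<in> edges (broom 1 n t m k)"
    proof cases
      case 1
      then show ?thesis unfolding E e by (simp add: g0 g1[simplified] insert_commute)
    next
      case 2
      then show ?thesis unfolding E e 2 using gP[of p] gP[of "p + 1"] by auto
    next
      case 3
      then show ?thesis unfolding E e 3 gL gK by auto
    next
      case 4
      then show ?thesis unfolding E e 4 g1 gK by auto
    qed
  next
    fix e assume "e \<in> edges (broom 1 n t m k)"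
    then consider (hub) "e = {HubU, HubV}" | (path) p where "e = {?P p, ?P (p + 1)}" "p + 1 < ?K"
      | (U) "e = {HubU, LeafU 0}" | (V) l where "e = {HubV, LeafV l}" "l < n"
      unfolding E by blast
    then obtain x y where xy: "e = {g x, g y}" "lasso_adj ?K n x y"
    proof cases
      case hub
      show thesis by (rule that[of 1 ?K]) (simp_all only: hub g1 gK lasso_adj_def simp_thms)
    next
      case path
      show thesis
        by (rule that[of "p + 1" "p + 1 + 1"])
          (use path gP[of p] gP[of "p + 1"] in \<open>auto simp: lasso_adj_def\<close>)
    next
      case U
      show thesis
      proof (rule that[of 0 1])
        show "e = {g 0, g 1}" unfolding U g0 g1 by (rule insert_commute)
      qed (use assms(6) in \<open>simp add: lasso_adj_def\<close>)
    next
      case V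
      show thesis
      proof (rule that[of ?K "?K + 1 + l"])
        show "e = {g ?K, g (?K + 1 + l)}" unfolding V gK gL ..
      qed (use V(2) in \<open>simp add: lasso_adj_def\<close>)
    qed
    then have "{x, y} \<in> edges (lasso ?K n)" by (simp add: lasso_edge_iff)
    then have "g ` {x, y} \<in> (`) g ` edges (lasso ?K n)" by (rule imageI)
    then show "e \<in> (`) g ` edges (lasso ?K n)" using xy(1) by simp
  qed
  ultimately show ?thesis unfolding isomorphic_def by auto
qed

lemma dern_broom_one_path:
  assumes "\<forall>i\<in>{2..t}. 3 \<le> k i" "1 \<le> t" "k 1 = 2" "m 1 = 1"
    and "(\<Sum>i=2..t. m i) = 1" "1 \<le> n"
  shows "dern (broom 1 n t m k) =
    (if (\<forall>j\<in>{2..t}. 0 < m j \<longrightarrow> 3 < k j) \<and> n \<le> 4 then 2 else 1)"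
proof -
  obtain i where i: "i \<in> {2..t}" "m i = 1" "\<And>j. j \<in> {2..t} \<Longrightarrow> j \<noteq> i \<Longrightarrow> m j = 0"
    using assms(5) sum_eq_Suc0_iff[of "{2..t}" m] by fastforce
  have iso: "lasso (k i) n \<cong>\<^sub>g broom 1 n t m k"
    using i assms by (intro lasso_isomorphic_broom) auto
  have "dern (broom 1 n t m k) = dern (lasso (k i) n)"
    using dern_isomorphic[OF simple_graph_lasso[OF bspec[OF assms(1) i(1)]] iso] by simp
  moreover have "(\<forall>j\<in>{2..t}. 0 < m j \<longrightarrow> 3 < k j) \<longleftrightarrow> 3 < k i"
    using i by (metis less_numeral_extra(1) less_numeral_extra(3))
  ultimately show ?thesis using dern_lasso[OF bspec[OF assms(1) i(1)] assms(6)] by simp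
qed

text \<open>Naming the hubs is a matter of choice, so the condition on leaves is stated for both
  orders. Path lengths are tested only where \<open>0 < m j\<close>, that is, on paths that
  occur.\<close>

theorem theorem2p4:
  fixes G :: "'a ugraph" and n1 n2 t :: nat and m k :: "nat \<Rightarrow> nat"
  assumes "simple_graph G"
    and "is_strong_double_broom n1 n2 t m k"
    and "k 1 = 2" and "m 1 = 1"
    and "G \<cong>\<^sub>g broom n1 n2 t m k"
  shows "dern G =
    (if (\<Sum>i=2..t. m i) = 1 \<and> (\<forall>j\<in>{2..t}. 0 < m j \<longrightarrow> 3 < k j) \<and>
        (n1 = 1 \<and> n2 \<le> 4 \<or> n2 = 1 \<and> n1 \<le> 4)
     then 2 else 1)"
proof -
  let ?M = "\<Sum>i=2..t. m i" and ?B = "broom n1 n2 t m k"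
  have n: "1 \<le> n1" "1 \<le> n2" and mono: "strict_mono_on {1..t} k"
    and k2: "\<forall>i\<in>{1..t}. 2 \<le> k i" and sum: "2 \<le> (\<Sum>i=1..t. m i)"
    using assms(2) unfolding is_strong_double_broom_def by auto
  have t: "1 \<le> t" using sum by (cases t) auto
  have k3: "\<forall>i\<in>{2..t}. 3 \<le> k i"
  proof
    fix i assume "i \<in> {2..t}"
    then show "3 \<le> k i" using strict_mono_onD[OF mono, of 1 i] assms(3) by auto
  qed
  have M: "1 \<le> ?M"
    using sum assms(4) sum.atLeast_Suc_atMost[OF t, of m] by (simp add: numeral_2_eq_2)
  have B: "simple_graph ?B" by (rule isomorphic_simple_graph[OF assms(1,5)])
  have dern: "dern G = dern ?B" by (rule dern_isomorphic[OF assms(1,5)])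
  have iso: "?B \<cong>\<^sub>g broom n2 n1 t m k" by (rule broom_swap[OF k2, where i = 1]) (use t assms(4) in auto)
  have dern': "dern G = dern (broom n2 n1 t m k)" using dern dern_isomorphic[OF B iso] by simp
  \<comment> \<open>All three numbers are positive, so a sum below 3 means that both of its terms
    are 1.\<close>
  consider "3 \<le> n1 + ?M" "3 \<le> n2 + ?M" | "?M = 1" "n1 = 1" | "?M = 1" "n2 = 1"
    using n M by linarith
  then show ?thesis
  proof cases
    case 1
    then have "dern G = 1"
      using dern_broom_large_hubs[OF B k3 t assms(3)] assms(4) dern by simp
    moreover have "\<not> (?M = 1 \<and> (n1 = 1 \<or> n2 = 1))" using 1 by auto
    ultimately show ?thesis by auto
  next
    case 2
    then have "dern G = (if (\<forall>j\<in>{2..t}. 0 < m j \<longrightarrow> 3 < k j) \<and> n2 \<le> 4 then 2 else 1)"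
      using dern dern_broom_one_path[where n = n2 and t = t and m = m and k = k] k3 t assms(3,4) n by simp
    then show ?thesis using 2 n by auto
  next
    case 3
    then have "dern G = (if (\<forall>j\<in>{2..t}. 0 < m j \<longrightarrow> 3 < k j) \<and> n1 \<le> 4 then 2 else 1)"
      using dern' dern_broom_one_path[where n = n1 and t = t and m = m and k = k] k3 t assms(3,4) n by simp
    then show ?thesis using 3 n by auto
  qed
qed

end
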